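(* Let $T=k\langle x_1,\dots,x_n\rangle/(\alpha_{ij}x_ix_j+x_jx_i)_{1\leq i,j\leq n,\,i\neq j}$ be a skew polynomial algebra, where $\alpha_{ij}\in k$ satisfy $\alpha_{ij}\alpha_{ji}=1$ for all $i\neq j$ and $\deg x_i=1$ for all $i$, and put $S=T/(x_1^2,\dots,x_{n-1}^2)$. Let $f=x_n^2\in S_2$, so that $A=S/(f)$ is a skew exterior algebra. Suppose that $\alpha_{ij}\alpha_{jk}\alpha_{ki}=1$ for all pairwise distinct $1\leq i,j,k\leq n$ (e.g. $A$ is the exterior algebra). Then for each integer $r\geq1$ there exist infinitely many isomorphism classes of indecomposable $\phi\in\operatorname{NMF}^0_S(f)$ of rank $r$.
   Context: $k$ is a fixed field. Graded right modules have degree-preserving homomorphisms; $M(n)_i=M_{n+i}$. The element $f=x_n^2\in S_2$ is regular (neither left nor right zero divisor) and normal ($Sf=fS$). A noncommutative graded right matrix factorization of $f\in S_d$ (here $d=2$) over $S$ is a sequence $\{\phi^i:F^{i+1}\to F^i\}_{i\in\mathbb Z}$ of graded right $S$-module homomorphisms, where for some $r\in\mathbb N$ (the rank) all $F^i$ are graded free right $S$-modules of rank $r$, such that for every $i$ there are isomorphisms $F^{i+2}\cong\bigoplus_{s=1}^rS(-m_{i+2,s})=\bigoplus_{s=1}^rS(-m_{is}-d)$ and $F^i\cong\bigoplus_{s=1}^rS(-m_{is})$ under which $\phi^i\phi^{i+1}$ corresponds to left multiplication by $f$. A morphism $\{\phi^i:F^{i+1}\to F^i\}\to\{\psi^i:G^{i+1}\to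 G^i\}$ is a sequence of graded homomorphisms $\mu^i:F^i\to G^i$ with $\mu^i\phi^i=\psi^i\mu^{i+1}$ for all $i$. The resulting additive category is $\operatorname{NMF}^{\mathbb Z}_S(f)$, and $\operatorname{NMF}^0_S(f)$ is its full subcategory of objects with $F^0\cong S^r$, i.e. $F^0$ generated in degree $0$. By convention one works with the equivalent full subcategory of objects with $F^i=\bigoplus_sS(-m_{is})$, $m_{i+2,s}=m_{is}+d$, and $\phi^i\phi^{i+1}=f\cdot$ exactly.
   Formalization: The field k is assumed infinite and n ≥ 2: over a finite k there are only finitely many classes of each rank r, and for n = 1 the only indecomposables of (k[x], x²) are (1,f), (x,x), (f,1), so the claim fails in both cases. *)

theory Defs
  imports "HOL-Algebra.Algebra" "HOL-Library.Poly_Mapping"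
begin

section \<open>The free algebra and its quotients\<close>

text \<open>
  Words form the free monoid, written additively so that the convolution product on
  \<open>nat list \<Rightarrow>\<^sub>0 'k\<close> is the product of noncommutative polynomials.
\<close>

instantiation list :: (type) monoid_add
begin
definition zero_list :: "'a list" where "zero_list = []"
definition plus_list :: "'a list \<Rightarrow> 'a list \<Rightarrow> 'a list" where "plus_list = (@)"
instance by standard (simp_all add: zero_list_def plus_list_def)
end

definition free_algebra :: "nat \<Rightarrow> (nat list \<Rightarrow>\<^sub>0 'k::field) ring" where
  "free_algebra n = \<lparr>carrier = {p. Poly_Mapping.keys p \<subseteq> lists {1..n}},
     monoid.mult = (*), one = 1, ring.zero = 0, add = (+)\<rparr>"

lemma carrier_free_algebra: "carrier (free_algebra n) = {p. Poly_Mapping.keys p \<subseteq> lists {1..n}}"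
  by (simp add: free_algebra_def)

text \<open>\<open>Idl\<close> is only meaningful over a ring, hence this lemma and \<open>ring_skew_T\<close> below.\<close>

lemma ring_free_algebra: "ring (free_algebra n :: (nat list \<Rightarrow>\<^sub>0 'k::field) ring)"
proof -
  let ?C = "carrier (free_algebra n :: (nat list \<Rightarrow>\<^sub>0 'k) ring)"
  have mult: "p * q \<in> ?C" if "p \<in> ?C" "q \<in> ?C" for p q
    using keys_mult[of p q] that
    by (fastforce simp: carrier_free_algebra plus_list_def)
  have add: "p + q \<in> ?C" if "p \<in> ?C" "q \<in> ?C" for p q
    using keys_add[of p q] that by (auto simp: carrier_free_algebra)
  have minus: "\<exists>q\<in>?C. q + p = 0" if "p \<in> ?C" for p
    using that by (intro bexI[of _ "- p"]) (auto simp: carrier_free_algebra)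
  have one: "1 \<in> ?C" and zero: "0 \<in> ?C"
    by (auto simp: carrier_free_algebra zero_list_def)
  show ?thesis
  proof (intro ringI abelian_groupI monoidI)
    fix p assume "p \<in> ?C"
    then show "\<exists>q\<in>?C. q \<oplus>\<^bsub>free_algebra n\<^esub> p = \<zero>\<^bsub>free_algebra n\<^esub>"
      using minus by (simp add: free_algebra_def)
  qed (use mult add one zero in \<open>simp_all add: free_algebra_def algebra_simps\<close>)
qed

definition fvar :: "nat \<Rightarrow> (nat list \<Rightarrow>\<^sub>0 'k::field)" where
  "fvar i = Poly_Mapping.single [i] 1"

definition fconst :: "'k::field \<Rightarrow> (nat list \<Rightarrow>\<^sub>0 'k)" where
  "fconst c = Poly_Mapping.single [] c"

definition fhomog :: "nat \<Rightarrow> int \<Rightarrow> (nat list \<Rightarrow>\<^sub>0 'k::field) set" where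
  "fhomog n d = {p \<in> carrier (free_algebra n). \<forall>w\<in>Poly_Mapping.keys p. int (length w) = d}"

definition skew_rels :: "nat \<Rightarrow> (nat \<Rightarrow> nat \<Rightarrow> 'k) \<Rightarrow> (nat list \<Rightarrow>\<^sub>0 'k::field) set" where
  "skew_rels n \<alpha> =
     {fconst (\<alpha> i j) * fvar i * fvar j + fvar j * fvar i | i j. i \<in> {1..n} \<and> j \<in> {1..n} \<and> i \<noteq> j}"

definition skew_ideal :: "nat \<Rightarrow> (nat \<Rightarrow> nat \<Rightarrow> 'k) \<Rightarrow> (nat list \<Rightarrow>\<^sub>0 'k::field) set" where
  "skew_ideal n \<alpha> = Idl\<^bsub>free_algebra n\<^esub> (skew_rels n \<alpha>)"

definition skew_T :: "nat \<Rightarrow> (nat \<Rightarrow> nat \<Rightarrow> 'k::field) \<Rightarrow> (nat list \<Rightarrow>\<^sub>0 'k) set ring" where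
  "skew_T n \<alpha> = free_algebra n Quot skew_ideal n \<alpha>"

lemma ring_skew_T:
  fixes \<alpha> :: "nat \<Rightarrow> nat \<Rightarrow> 'k::field"
  shows "ring (skew_T n \<alpha>)"
proof -
  interpret F: ring "free_algebra n :: (nat list \<Rightarrow>\<^sub>0 'k) ring"
    by (rule ring_free_algebra)
  have const: "fconst c \<in> carrier (free_algebra n)" for c :: 'k
    by (simp add: carrier_free_algebra fconst_def)
  have var: "fvar i \<in> carrier (free_algebra n :: (nat list \<Rightarrow>\<^sub>0 'k) ring)" if "i \<in> {1..n}" for i
    using that by (simp add: carrier_free_algebra fvar_def)
  have mult: "p * q \<in> carrier (free_algebra n)"
    if "p \<in> carrier (free_algebra n)" "q \<in> carrier (free_algebra n)" for p q :: "nat list \<Rightarrow>\<^sub>0 'k"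
    using F.m_closed[OF that] by (simp add: free_algebra_def)
  have add: "p + q \<in> carrier (free_algebra n)"
    if "p \<in> carrier (free_algebra n)" "q \<in> carrier (free_algebra n)" for p q :: "nat list \<Rightarrow>\<^sub>0 'k"
    using F.a_closed[OF that] by (simp add: free_algebra_def)
  have "skew_rels n \<alpha> \<subseteq> carrier (free_algebra n)"
    unfolding skew_rels_def by (auto intro!: add mult const var)
  then have "ideal (skew_ideal n \<alpha>) (free_algebra n)"
    unfolding skew_ideal_def by (rule F.genideal_ideal)
  then show ?thesis
    unfolding skew_T_def by (rule ideal.quotient_is_ring)
qed

definition proj_T :: "nat \<Rightarrow> (nat \<Rightarrow> nat \<Rightarrow> 'k::field) \<Rightarrow> (nat list \<Rightarrow>\<^sub>0 'k) \<Rightarrow> (nat list \<Rightarrow>\<^sub>0 'k) set" where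
  "proj_T n \<alpha> p = skew_ideal n \<alpha> +>\<^bsub>free_algebra n\<^esub> p"

definition square_ideal :: "nat \<Rightarrow> (nat \<Rightarrow> nat \<Rightarrow> 'k::field) \<Rightarrow> (nat list \<Rightarrow>\<^sub>0 'k) set set" where
  "square_ideal n \<alpha> = Idl\<^bsub>skew_T n \<alpha>\<^esub>
     {proj_T n \<alpha> (fvar i) \<otimes>\<^bsub>skew_T n \<alpha>\<^esub> proj_T n \<alpha> (fvar i) | i. i \<in> {1..n-1}}"

definition proj_S :: "nat \<Rightarrow> (nat \<Rightarrow> nat \<Rightarrow> 'k::field) \<Rightarrow> (nat list \<Rightarrow>\<^sub>0 'k) \<Rightarrow> (nat list \<Rightarrow>\<^sub>0 'k) set set" where
  "proj_S n \<alpha> p = square_ideal n \<alpha> +>\<^bsub>skew_T n \<alpha>\<^esub> proj_T n \<alpha> p"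

record 'a gr_ring = "'a ring" +
  homog :: "int \<Rightarrow> 'a set"

text \<open>
  The grading is induced by \<open>deg x\<^sub>i = 1\<close>: the defining relations are homogeneous, so the degree
  \<open>d\<close> part of the quotient is the image of the degree \<open>d\<close> part of the free algebra.
\<close>

definition skew_S :: "nat \<Rightarrow> (nat \<Rightarrow> nat \<Rightarrow> 'k::field) \<Rightarrow> (nat list \<Rightarrow>\<^sub>0 'k) set set gr_ring" where
  "skew_S n \<alpha> = ring.extend (skew_T n \<alpha> Quot square_ideal n \<alpha>)
     (gr_ring.fields (\<lambda>d. proj_S n \<alpha> ` fhomog n d))"

definition x_S :: "nat \<Rightarrow> (nat \<Rightarrow> nat \<Rightarrow> 'k::field) \<Rightarrow> nat \<Rightarrow> (nat list \<Rightarrow>\<^sub>0 'k) set set" where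
  "x_S n \<alpha> i = proj_S n \<alpha> (fvar i)"


section \<open>Graded right modules\<close>

record ('a, 'm) gr_rmod = "'m partial_object" +
  madd :: "'m \<Rightarrow> 'm \<Rightarrow> 'm"
  mzero :: 'm
  ract :: "'m \<Rightarrow> 'a \<Rightarrow> 'm"
  gcomp :: "int \<Rightarrow> 'm set"

definition graded_hom ::
  "('a, 'r) gr_ring_scheme \<Rightarrow> ('a, 'm) gr_rmod \<Rightarrow> ('a, 'n) gr_rmod \<Rightarrow> ('m \<Rightarrow> 'n) set" where
  "graded_hom S M N = {g \<in> carrier M \<rightarrow> carrier N.
     (\<forall>u\<in>carrier M. \<forall>v\<in>carrier M. g (madd M u v) = madd N (g u) (g v)) \<and>
     (\<forall>u\<in>carrier M. \<forall>a\<in>carrier S. g (ract M u a) = ract N (g u) a) \<and>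
     (\<forall>j. g ` gcomp M j \<subseteq> gcomp N j)}"

definition graded_iso ::
  "('a, 'r) gr_ring_scheme \<Rightarrow> ('a, 'm) gr_rmod \<Rightarrow> ('a, 'n) gr_rmod \<Rightarrow> bool" where
  "graded_iso S M N \<longleftrightarrow> (\<exists>g\<in>graded_hom S M N. \<exists>h\<in>graded_hom S N M.
     (\<forall>u\<in>carrier M. h (g u) = u) \<and> (\<forall>v\<in>carrier N. g (h v) = v))"

definition regular_mod :: "('a, 'r) gr_ring_scheme \<Rightarrow> ('a, 'a) gr_rmod" where
  "regular_mod S = \<lparr>carrier = carrier S, madd = add S, mzero = \<zero>\<^bsub>S\<^esub>,
     ract = monoid.mult S, gcomp = homog S\<rparr>"

definition shift :: "('a, 'm) gr_rmod \<Rightarrow> int \<Rightarrow> ('a, 'm) gr_rmod" where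
  "shift M n = M\<lparr>gcomp := (\<lambda>i. gcomp M (n + i))\<rparr>"

definition direct_sum :: "nat \<Rightarrow> (nat \<Rightarrow> ('a, 'm) gr_rmod) \<Rightarrow> ('a, nat \<Rightarrow> 'm) gr_rmod" where
  "direct_sum r M =
    \<lparr>carrier = (\<Pi>\<^sub>E s\<in>{..<r}. carrier (M s)),
     madd = (\<lambda>u v. \<lambda>s\<in>{..<r}. madd (M s) (u s) (v s)),
     mzero = (\<lambda>s\<in>{..<r}. mzero (M s)),
     ract = (\<lambda>u a. \<lambda>s\<in>{..<r}. ract (M s) (u s) a),
     gcomp = (\<lambda>j. \<Pi>\<^sub>E s\<in>{..<r}. gcomp (M s) j)\<rparr>"

text \<open>\<open>free_mod S r m\<close> is \<open>S(-m\<^sub>0) \<oplus> \<dots> \<oplus> S(-m\<^sub>r\<^sub>-\<^sub>1)\<close>.\<close>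

definition free_mod ::
  "('a, 'r) gr_ring_scheme \<Rightarrow> nat \<Rightarrow> (nat \<Rightarrow> int) \<Rightarrow> ('a, nat \<Rightarrow> 'a) gr_rmod" where
  "free_mod S r m = direct_sum r (\<lambda>s. shift (regular_mod S) (- m s))"


section \<open>Noncommutative graded right matrix factorizations\<close>

text \<open>
  The normalised form of a factorization is used: \<open>F\<^sup>i\<close> is literally the sum of the
  \<open>S(-m\<^sub>i\<^sub>s)\<close>, indexed here by \<open>s < r\<close>, and \<open>\<phi>\<^sup>i \<phi>\<^sup>i\<^sup>+\<^sup>1\<close> is literally left multiplication by \<open>f\<close>.
  Only the values of \<open>twist\<close> below the rank and of \<open>dmap i\<close> on \<open>F\<^sup>i\<^sup>+\<^sup>1\<close> are meaningful;
  records differing elsewhere are isomorphic objects.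
\<close>

record 'a mfact =
  rk :: nat
  twist :: "int \<Rightarrow> nat \<Rightarrow> int"
  dmap :: "int \<Rightarrow> (nat \<Rightarrow> 'a) \<Rightarrow> (nat \<Rightarrow> 'a)"

definition mf_mod :: "('a, 'r) gr_ring_scheme \<Rightarrow> 'a mfact \<Rightarrow> int \<Rightarrow> ('a, nat \<Rightarrow> 'a) gr_rmod" where
  "mf_mod S P i = free_mod S (rk P) (twist P i)"

definition NMF :: "('a, 'r) gr_ring_scheme \<Rightarrow> int \<Rightarrow> 'a \<Rightarrow> 'a mfact set" where
  "NMF S d f = {P.
     (\<forall>i. \<forall>s<rk P. twist P (i + 2) s = twist P i s + d) \<and>
     (\<forall>i. dmap P i \<in> graded_hom S (mf_mod S P (i + 1)) (mf_mod S P i)) \<and>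
     (\<forall>i. \<forall>v\<in>carrier (mf_mod S P (i + 2)).
        dmap P i (dmap P (i + 1) v) = (\<lambda>s\<in>{..<rk P}. f \<otimes>\<^bsub>S\<^esub> v s))}"

definition NMF0 :: "('a, 'r) gr_ring_scheme \<Rightarrow> int \<Rightarrow> 'a \<Rightarrow> 'a mfact set" where
  "NMF0 S d f = {P \<in> NMF S d f. graded_iso S (mf_mod S P 0) (free_mod S (rk P) (\<lambda>_. 0))}"

definition mf_hom ::
  "('a, 'r) gr_ring_scheme \<Rightarrow> 'a mfact \<Rightarrow> 'a mfact \<Rightarrow> (int \<Rightarrow> (nat \<Rightarrow> 'a) \<Rightarrow> (nat \<Rightarrow> 'a)) set" where
  "mf_hom S P Q = {g.
     (\<forall>i. g i \<in> graded_hom S (mf_mod S P i) (mf_mod S Q i)) \<and>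
     (\<forall>i. \<forall>v\<in>carrier (mf_mod S P (i + 1)). g i (dmap P i v) = dmap Q i (g (i + 1) v))}"

definition mf_iso :: "('a, 'r) gr_ring_scheme \<Rightarrow> 'a mfact \<Rightarrow> 'a mfact \<Rightarrow> bool" where
  "mf_iso S P Q \<longleftrightarrow> (\<exists>g\<in>mf_hom S P Q. \<exists>h\<in>mf_hom S Q P.
     (\<forall>i. \<forall>u\<in>carrier (mf_mod S P i). h i (g i u) = u) \<and>
     (\<forall>i. \<forall>v\<in>carrier (mf_mod S Q i). g i (h i v) = v))"

text \<open>The coordinates of \<open>P\<close> come first, followed by those of \<open>Q\<close>.\<close>

definition mf_sum :: "'a mfact \<Rightarrow> 'a mfact \<Rightarrow> 'a mfact" where
  "mf_sum P Q =
    \<lparr>rk = rk P + rk Q,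
     twist = (\<lambda>i s. if s < rk P then twist P i s else twist Q i (s - rk P)),
     dmap = (\<lambda>i v. \<lambda>s\<in>{..<rk P + rk Q}.
       if s < rk P then dmap P i (\<lambda>t\<in>{..<rk P}. v t) s
       else dmap Q i (\<lambda>t\<in>{..<rk Q}. v (rk P + t)) (s - rk P))\<rparr>"

definition mf_zero :: "('a, 'r) gr_ring_scheme \<Rightarrow> 'a mfact \<Rightarrow> bool" where
  "mf_zero S P \<longleftrightarrow> (\<forall>i. carrier (mf_mod S P i) = {mzero (mf_mod S P i)})"

definition indecomposable :: "('a, 'r) gr_ring_scheme \<Rightarrow> 'a mfact set \<Rightarrow> 'a mfact \<Rightarrow> bool" where
  "indecomposable S C P \<longleftrightarrow> P \<in> C \<and> \<not> mf_zero S P \<and>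
     (\<forall>Q\<in>C. \<forall>R\<in>C. mf_iso S P (mf_sum Q R) \<longrightarrow> mf_zero S Q \<or> mf_zero S R)"

definition iso_classes :: "('a, 'r) gr_ring_scheme \<Rightarrow> 'a mfact set \<Rightarrow> 'a mfact set set" where
  "iso_classes S C = C // {(P, Q). P \<in> C \<and> Q \<in> C \<and> mf_iso S P Q}"

end

theory Submission
  imports Defs
begin

text \<open>
  Put \<open>x = x\<^sub>1\<close>, \<open>y = x\<^sub>n\<close>, \<open>q = \<alpha>\<^sub>1\<^sub>n\<close>. Since \<open>x\<^sup>2 = 0\<close> and \<open>y x = - q x y\<close>, for every square matrix \<open>J\<close> over
  the field the matrices \<open>\<phi>\<^sup>i = y + q\<^sup>-\<^sup>i x J\<close> satisfy \<open>\<phi>\<^sup>i \<phi>\<^sup>i\<^sup>+\<^sup>1 = y\<^sup>2\<close>, hence form a factorization with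
  \<open>F\<^sup>i = S(-i)\<^sup>r\<close>. Graded maps between two of these are given in degrees \<open>0\<close> and \<open>1\<close> by matrices over
  \<open>S\<^sub>0 = k\<close>; as \<open>x\<close> and \<open>y\<close> are linearly independent, these two matrices coincide and intertwine the
  matrices \<open>J\<close>. For Jordan blocks of size \<open>r\<close> every idempotent endomorphism is then trivial, and
  different eigenvalues give non-isomorphic factorizations.
\<close>

section \<open>Free graded modules, graded maps and morphisms of factorizations\<close>

lemma free_mod_simps:
  "carrier (free_mod S r m) = (\<Pi>\<^sub>E s\<in>{..<r}. carrier S)"
  "madd (free_mod S r m) u v = (\<lambda>s\<in>{..<r}. u s \<oplus>\<^bsub>S\<^esub> v s)"
  "mzero (free_mod S r m) = (\<lambda>s\<in>{..<r}. \<zero>\<^bsub>S\<^esub>)"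
  "ract (free_mod S r m) u a = (\<lambda>s\<in>{..<r}. u s \<otimes>\<^bsub>S\<^esub> a)"
  "gcomp (free_mod S r m) j = (\<Pi>\<^sub>E s\<in>{..<r}. homog S (j - m s))"
  by (simp_all add: free_mod_def direct_sum_def shift_def regular_mod_def)

lemma graded_homI:
  assumes "\<And>v. v \<in> carrier M \<Longrightarrow> g v \<in> carrier N"
    and "\<And>u v. u \<in> carrier M \<Longrightarrow> v \<in> carrier M \<Longrightarrow> g (madd M u v) = madd N (g u) (g v)"
    and "\<And>u a. u \<in> carrier M \<Longrightarrow> a \<in> carrier S \<Longrightarrow> g (ract M u a) = ract N (g u) a"
    and "\<And>j v. v \<in> gcomp M j \<Longrightarrow> g v \<in> gcomp N j"
  shows "g \<in> graded_hom S M N"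
  using assms by (auto simp: graded_hom_def)

lemma graded_homD:
  assumes "g \<in> graded_hom S M N"
  shows "v \<in> carrier M \<Longrightarrow> g v \<in> carrier N"
    and "u \<in> carrier M \<Longrightarrow> v \<in> carrier M \<Longrightarrow> g (madd M u v) = madd N (g u) (g v)"
    and "u \<in> carrier M \<Longrightarrow> a \<in> carrier S \<Longrightarrow> g (ract M u a) = ract N (g u) a"
    and "v \<in> gcomp M j \<Longrightarrow> g v \<in> gcomp N j"
  using assms by (auto simp: graded_hom_def image_subset_iff)

lemma graded_hom_id: "(\<lambda>v. v) \<in> graded_hom S M M"
  by (rule graded_homI) auto

lemma graded_hom_comp:
  assumes "g \<in> graded_hom S L M" "h \<in> graded_hom S M N"
  shows "(\<lambda>v. h (g v)) \<in> graded_hom S L N"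
  by (rule graded_homI) (use graded_homD[OF assms(1)] graded_homD[OF assms(2)] in auto)

lemma mf_homD:
  assumes "g \<in> mf_hom S P Q"
  shows "g i \<in> graded_hom S (mf_mod S P i) (mf_mod S Q i)"
    and "v \<in> carrier (mf_mod S P (i + 1)) \<Longrightarrow> g i (dmap P i v) = dmap Q i (g (i + 1) v)"
  using assms by (auto simp: mf_hom_def)

lemma mf_hom_comp:
  assumes "g \<in> mf_hom S P Q" "h \<in> mf_hom S Q R"
  shows "(\<lambda>i v. h i (g i v)) \<in> mf_hom S P R"
proof -
  have "h i (g i (dmap P i v)) = dmap R i (h (i + 1) (g (i + 1) v))"
    if "v \<in> carrier (mf_mod S P (i + 1))" for i v
    using mf_homD[OF assms(1)] mf_homD[OF assms(2)] graded_homD(1) that by metis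
  then show ?thesis
    using mf_homD[OF assms(1)] mf_homD[OF assms(2)] graded_hom_comp
    by (fastforce simp: mf_hom_def)
qed

lemma mf_iso_refl: "mf_iso S P P"
  unfolding mf_iso_def mf_hom_def
  by (rule bexI[of _ "\<lambda>i v. v"], rule bexI[of _ "\<lambda>i v. v"]) (auto intro: graded_hom_id)

section \<open>Graded rings and projections onto summands\<close>

locale graded_ring = ring S for S :: "('a, 'b) gr_ring_scheme" (structure) +
  assumes homog_carrier: "u \<in> homog S i \<Longrightarrow> u \<in> carrier S"
    and homog_zero [simp, intro]: "\<zero> \<in> homog S i"
    and homog_add [intro]: "u \<in> homog S i \<Longrightarrow> v \<in> homog S i \<Longrightarrow> u \<oplus> v \<in> homog S i"
    and homog_mult: "u \<in> homog S i \<Longrightarrow> v \<in> homog S j \<Longrightarrow> u \<otimes> v \<in> homog S (i + j)"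
begin

text \<open>The zero tuple is its own right multiple by \<open>\<zero>\<close>, so linearity over
  \<open>S\<close> settles the claim without any cancellation in the target.\<close>

lemma graded_hom_zero:
  assumes "g \<in> graded_hom S (free_mod S r m) (free_mod S r' m')"
  shows "g (\<lambda>s\<in>{..<r}. \<zero>) = (\<lambda>s\<in>{..<r'}. \<zero>)"
proof -
  let ?z = "(\<lambda>s\<in>{..<r}. \<zero>)"
  have z: "?z \<in> carrier (free_mod S r m)"
    by (simp add: free_mod_simps)
  have "ract (free_mod S r m) ?z \<zero> = ?z"
    by (auto simp: free_mod_simps fun_eq_iff restrict_def)
  then have "g ?z = (\<lambda>s\<in>{..<r'}. g ?z s \<otimes> \<zero>)"
    using graded_homD(3)[OF assms z zero_closed] by (simp add: free_mod_simps)
  also have "\<dots> = (\<lambda>s\<in>{..<r'}. \<zero>)"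
  proof (rule restrict_ext)
    fix s assume "s \<in> {..<r'}"
    with graded_homD(1)[OF assms z] show "g ?z s \<otimes> \<zero> = \<zero>"
      unfolding free_mod_simps by (intro r_null) (rule PiE_mem)
  qed
  finally show ?thesis .
qed

text \<open>\<open>summand_proj m m' b\<close> is the projection of a sum of ranks \<open>m + m'\<close> onto its first (\<open>b\<close>)
  or second (\<open>\<not> b\<close>) summand, followed by the inclusion.\<close>

definition summand_proj :: "nat \<Rightarrow> nat \<Rightarrow> bool \<Rightarrow> (nat \<Rightarrow> 'a) \<Rightarrow> nat \<Rightarrow> 'a" where
  "summand_proj m m' b v = (\<lambda>s\<in>{..<m + m'}. if (s < m) = b then v s else \<zero>)"

text \<open>The differential of a direct sum is block diagonal and each block preserves zero, so
  erasing one block of coordinates commutes with it.\<close>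

lemma summand_proj_mf_hom:
  assumes P: "P \<in> NMF S d f" and Q: "Q \<in> NMF S d f"
  shows "(\<lambda>_. summand_proj (rk P) (rk Q) b) \<in> mf_hom S (mf_sum P Q) (mf_sum P Q)"
proof -
  let ?p = "rk P" and ?q = "rk Q"
  let ?pr = "summand_proj ?p ?q b"
  have dP: "dmap P i \<in> graded_hom S (free_mod S ?p (twist P (i + 1))) (free_mod S ?p (twist P i))" for i
    using P by (simp add: NMF_def mf_mod_def)
  have dQ: "dmap Q i \<in> graded_hom S (free_mod S ?q (twist Q (i + 1))) (free_mod S ?q (twist Q i))" for i
    using Q by (simp add: NMF_def mf_mod_def)
  have "?pr \<in> graded_hom S (mf_mod S (mf_sum P Q) i) (mf_mod S (mf_sum P Q) i)" for i
  proof (rule graded_homI)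
    fix j v assume "v \<in> gcomp (mf_mod S (mf_sum P Q) i) j"
    then have v: "v s \<in> homog S (j - (if s < ?p then twist P i s else twist Q i (s - ?p)))"
      if "s < ?p + ?q" for s
      using that by (auto simp: mf_mod_def mf_sum_def free_mod_simps PiE_iff)
    show "?pr v \<in> gcomp (mf_mod S (mf_sum P Q) i) j"
      using v by (fastforce simp: mf_mod_def mf_sum_def free_mod_simps summand_proj_def)
  qed (auto simp: mf_mod_def mf_sum_def free_mod_simps summand_proj_def fun_eq_iff
        restrict_def PiE_iff extensional_def)
  moreover have "?pr (dmap (mf_sum P Q) i v) = dmap (mf_sum P Q) i (?pr v)"
    if v: "v \<in> carrier (mf_mod S (mf_sum P Q) (i + 1))" for i v
  proof -
    \<comment> \<open>Each block of the projected tuple is either the old block or the zero tuple,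
      to which \<open>graded_hom_zero\<close> applies.\<close>
    have 1: "(\<lambda>t\<in>{..<?p}. ?pr v t) = (if b then (\<lambda>t\<in>{..<?p}. v t) else (\<lambda>t\<in>{..<?p}. \<zero>))"
      by (auto simp: summand_proj_def fun_eq_iff restrict_def)
    have 2: "(\<lambda>t\<in>{..<?q}. ?pr v (?p + t)) = (if b then (\<lambda>t\<in>{..<?q}. \<zero>) else (\<lambda>t\<in>{..<?q}. v (?p + t)))"
      by (auto simp: summand_proj_def fun_eq_iff restrict_def)
    show ?thesis
      using graded_hom_zero[OF dP] graded_hom_zero[OF dQ]
      by (auto simp: mf_sum_def 1 2 fun_eq_iff) (auto simp: summand_proj_def restrict_def)
  qed
  ultimately show ?thesis
    by (simp add: mf_hom_def)
qed

text \<open>Position 0 is enough to detect a trivial summand: all modules of a factorization have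
  the same rank, and a summand of positive rank would contribute a coordinate equal to
  \<open>\<one>\<close>.\<close>

lemma mf_zero_if_summand_proj_zero:
  assumes "\<one> \<noteq> \<zero>"
    and "\<And>v. v \<in> carrier (mf_mod S (mf_sum P Q) 0) \<Longrightarrow>
      summand_proj (rk P) (rk Q) b v = (\<lambda>s\<in>{..<rk P + rk Q}. \<zero>)"
  shows "mf_zero S (if b then P else Q)"
proof -
  have "rk (if b then P else Q) = 0"
  proof (rule ccontr)
    assume *: "rk (if b then P else Q) \<noteq> 0"
    \<comment> \<open>The first coordinate of the chosen summand inside the sum.\<close>
    define s where "s = (if b then 0 else rk P)"
    have s: "s < rk P + rk Q" "(s < rk P) = b"
      using * by (auto simp: s_def split: if_splits)
    have "summand_proj (rk P) (rk Q) b (\<lambda>s\<in>{..<rk P + rk Q}. \<one>) = (\<lambda>s\<in>{..<rk P + rk Q}. \<zero>)"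
      by (rule assms(2)) (auto simp: mf_mod_def mf_sum_def free_mod_simps)
    then have "summand_proj (rk P) (rk Q) b (\<lambda>s\<in>{..<rk P + rk Q}. \<one>) s = \<zero>"
      using s by simp
    then show False
      using s assms(1) by (simp add: summand_proj_def)
  qed
  then show ?thesis
    by (auto simp: mf_zero_def mf_mod_def free_mod_simps)
qed

end

section \<open>Factorizations from Jordan blocks\<close>

text \<open>Isolates the facts about the algebra on which the construction rests:
  \<open>\<kappa>\<close> is the central structure map from the field onto the degree 0 part, and
  \<open>indep\<close> is linear independence of \<open>y\<close> and \<open>x\<close> over the
  field. Taking both coefficients of \<open>x\<close> to be 0 in \<open>indep\<close> makes
  \<open>\<kappa>\<close> injective.\<close>

locale jordan_setup = graded_ring S for S :: "('a, 'b) gr_ring_scheme" (structure) +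
  fixes \<kappa> :: "'k::field \<Rightarrow> 'a" and x y :: 'a and q :: 'k
  assumes scal_closed [simp, intro]: "\<kappa> a \<in> carrier S"
    and scal_add: "\<kappa> (a + b) = \<kappa> a \<oplus> \<kappa> b"
    and scal_mult: "\<kappa> (a * b) = \<kappa> a \<otimes> \<kappa> b"
    and scal_one [simp]: "\<kappa> 1 = \<one>"
    and scal_central: "u \<in> carrier S \<Longrightarrow> u \<otimes> \<kappa> a = \<kappa> a \<otimes> u"
    and homog_0: "homog S 0 = range \<kappa>"
    and x_homog: "x \<in> homog S 1"
    and y_homog: "y \<in> homog S 1"
    and q_nz: "q \<noteq> 0"
    and x_sq: "x \<otimes> x = \<zero>"
    and skew: "\<kappa> q \<otimes> x \<otimes> y \<oplus> y \<otimes> x = \<zero>"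
    and indep: "y \<otimes> \<kappa> a \<oplus> x \<otimes> \<kappa> b = y \<otimes> \<kappa> a' \<oplus> x \<otimes> \<kappa> b' \<Longrightarrow> a = a' \<and> b = b'"
begin

lemma x_carrier [simp, intro]: "x \<in> carrier S" and y_carrier [simp, intro]: "y \<in> carrier S"
  using x_homog y_homog homog_carrier by auto

lemma scal_zero [simp]: "\<kappa> 0 = \<zero>"
  using scal_add[of 0 0] by (metis add.l_cancel_one' add.r_cancel_one' scal_closed add_0)

lemma scal_inj: "\<kappa> a = \<kappa> b \<longleftrightarrow> a = b"
  using indep[of a 0 b 0] by auto

lemma one_neq_zero: "\<one> \<noteq> \<zero>"
  using scal_inj[of 1 0] by simp

text \<open>The nilpotent part of the Jordan block. The test supplies \<open>\<zero>\<close> for the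
  coordinate after the last one, where an extensional tuple is \<open>undefined\<close>.\<close>

definition jshift :: "nat \<Rightarrow> (nat \<Rightarrow> 'a) \<Rightarrow> nat \<Rightarrow> 'a" where
  "jshift r v s = (if Suc s < r then v (Suc s) else \<zero>)"

definition jordan_op :: "nat \<Rightarrow> 'k \<Rightarrow> (nat \<Rightarrow> 'a) \<Rightarrow> nat \<Rightarrow> 'a" where
  "jordan_op r l v s = \<kappa> l \<otimes> v s \<oplus> jshift r v s"

definition jordan_mf :: "nat \<Rightarrow> 'k \<Rightarrow> 'a mfact" where
  "jordan_mf r l = \<lparr>rk = r, twist = (\<lambda>i s. i),
    dmap = (\<lambda>i v. \<lambda>s\<in>{..<r}. y \<otimes> v s \<oplus> \<kappa> (inverse q powi i) \<otimes> x \<otimes> jordan_op r l v s)\<rparr>"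

lemma mf_mod_jordan: "mf_mod S (jordan_mf r l) i = free_mod S r (\<lambda>_. i)"
  by (simp add: mf_mod_def jordan_mf_def)

lemma jordan_op_closed:
  "v \<in> {..<r} \<rightarrow> carrier S \<Longrightarrow> s < r \<Longrightarrow> jordan_op r l v s \<in> carrier S"
  by (auto simp: jordan_op_def jshift_def Pi_iff)

lemma jordan_op_add:
  assumes "u \<in> {..<r} \<rightarrow> carrier S" "v \<in> {..<r} \<rightarrow> carrier S" "s < r"
  shows "jordan_op r l (\<lambda>s\<in>{..<r}. u s \<oplus> v s) s = jordan_op r l u s \<oplus> jordan_op r l v s"
  using assms by (auto simp: jordan_op_def jshift_def Pi_iff r_distr a_ac)

lemma jordan_op_ract:
  assumes "u \<in> {..<r} \<rightarrow> carrier S" "a \<in> carrier S" "s < r"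
  shows "jordan_op r l (\<lambda>s\<in>{..<r}. u s \<otimes> a) s = jordan_op r l u s \<otimes> a"
  using assms by (auto simp: jordan_op_def jshift_def Pi_iff l_distr m_assoc)

text \<open>The entries of the block are central scalars, so it commutes with left multiplication as
  well; this moves it past \<open>x\<close> and \<open>y\<close> when two differentials are
  composed.\<close>

lemma jordan_op_lmult:
  assumes "u \<in> {..<r} \<rightarrow> carrier S" "a \<in> carrier S" "s < r"
  shows "jordan_op r l (\<lambda>s\<in>{..<r}. a \<otimes> u s) s = a \<otimes> jordan_op r l u s"
proof -
  have "\<kappa> l \<otimes> (a \<otimes> u s) = a \<otimes> (\<kappa> l \<otimes> u s)"
    using assms by (simp add: Pi_iff m_assoc[symmetric] scal_central)
  then show ?thesis
    using assms by (auto simp: jordan_op_def jshift_def Pi_iff r_distr)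
qed

text \<open>Multiplication by \<open>x\<close> or \<open>y\<close> raises the degree by one, which
  matches the drop of the twist from \<open>i + 1\<close> to \<open>i\<close>; the block itself has
  entries of degree 0.\<close>

lemma jordan_mf_graded_hom:
  "dmap (jordan_mf r l) i \<in> graded_hom S (free_mod S r (\<lambda>_. i + 1)) (free_mod S r (\<lambda>_. i))"
proof (rule graded_homI; unfold free_mod_simps)
  let ?d = "dmap (jordan_mf r l) i"
  fix u v assume u: "u \<in> (\<Pi>\<^sub>E s\<in>{..<r}. carrier S)"
  then have u': "u \<in> {..<r} \<rightarrow> carrier S"
    by auto
  show "?d u \<in> (\<Pi>\<^sub>E s\<in>{..<r}. carrier S)"
    using jordan_op_closed[OF u'] u' by (auto simp: jordan_mf_def Pi_iff)
  show "?d (\<lambda>s\<in>{..<r}. u s \<otimes> a) = (\<lambda>s\<in>{..<r}. ?d u s \<otimes> a)" if "a \<in> carrier S" for a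
    using jordan_op_closed[OF u'] u' that
    by (auto simp: jordan_mf_def Pi_iff jordan_op_ract[OF u'] m_assoc l_distr)
  assume v: "v \<in> (\<Pi>\<^sub>E s\<in>{..<r}. carrier S)"
  then have v': "v \<in> {..<r} \<rightarrow> carrier S"
    by auto
  show "?d (\<lambda>s\<in>{..<r}. u s \<oplus> v s) = (\<lambda>s\<in>{..<r}. ?d u s \<oplus> ?d v s)"
    using jordan_op_closed[OF u'] jordan_op_closed[OF v'] u' v'
    by (auto simp: jordan_mf_def Pi_iff jordan_op_add[OF u' v'] r_distr a_ac)
next
  fix j v assume "v \<in> (\<Pi>\<^sub>E s\<in>{..<r}. homog S (j - (i + 1)))"
  then have v: "v s \<in> homog S (j - (i + 1))" if "s < r" for s
    using that by auto
  have k: "\<kappa> a \<in> homog S 0" for a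
    by (simp add: homog_0)
  have "jordan_op r l v s \<in> homog S (j - (i + 1))" if "s < r" for s
    using homog_mult[OF k v[OF that], of l] v[of "Suc s"]
    by (auto simp: jordan_op_def jshift_def)
  then have "y \<otimes> v s \<oplus> \<kappa> (inverse q powi i) \<otimes> x \<otimes> jordan_op r l v s \<in> homog S (j - i)"
    if "s < r" for s
    using homog_mult[OF y_homog v[OF that]] homog_mult[OF homog_mult[OF k x_homog]] that
    by (fastforce intro!: homog_add)
  then show "dmap (jordan_mf r l) i v \<in> (\<Pi>\<^sub>E s\<in>{..<r}. homog S (j - i))"
    by (auto simp: jordan_mf_def)
qed

text \<open>Expand \<open>(y + c x J)(y + c' x J)\<close>, where \<open>c\<close> and
  \<open>c'\<close> are the weights at \<open>i\<close> and \<open>i + 1\<close>. The term in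
  \<open>J\<close> squared contains \<open>x \<otimes> x\<close>, and the mixed terms add up to
  \<open>c'\<close> times the skew relation applied to \<open>J v\<close>.\<close>

lemma jordan_mf_square:
  assumes "v \<in> (\<Pi>\<^sub>E s\<in>{..<r}. carrier S)"
  shows "dmap (jordan_mf r l) i (dmap (jordan_mf r l) (i + 1) v) = (\<lambda>s\<in>{..<r}. y \<otimes> y \<otimes> v s)"
proof
  fix s
  define c where "c = \<kappa> (inverse q powi i)"
  define c' where "c' = \<kappa> (inverse q powi (i + 1))"
  have cc [simp]: "c \<in> carrier S" "c' \<in> carrier S"
    by (simp_all add: c_def c'_def)
  \<comment> \<open>This recursion is the purpose of the weights: it turns \<open>c x y\<close> into
    \<open>c' q x y\<close>, the partner of \<open>c' y x\<close>.\<close>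
  have "inverse q powi i = inverse q powi (i + 1) * q"
    using q_nz by (simp add: power_int_add)
  then have c: "c = c' \<otimes> \<kappa> q"
    by (simp add: c_def c'_def scal_mult)
  have v: "v \<in> {..<r} \<rightarrow> carrier S"
    using assms by auto
  let ?J = "jordan_op r l"
  show "dmap (jordan_mf r l) i (dmap (jordan_mf r l) (i + 1) v) s = (\<lambda>s\<in>{..<r}. y \<otimes> y \<otimes> v s) s"
  proof (cases "s < r")
    case False
    then show ?thesis
      by (simp add: jordan_mf_def)
  next
    case s: True
    define Jv where "Jv = (\<lambda>s\<in>{..<r}. ?J v s)"
    have Jv: "Jv \<in> {..<r} \<rightarrow> carrier S"
      using jordan_op_closed[OF v] by (auto simp: Jv_def)
    let ?a = "\<lambda>s\<in>{..<r}. y \<otimes> v s" and ?b = "\<lambda>s\<in>{..<r}. c' \<otimes> x \<otimes> Jv s"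
    have ab: "?a \<in> {..<r} \<rightarrow> carrier S" "?b \<in> {..<r} \<rightarrow> carrier S"
      using v Jv by auto
    have d: "dmap (jordan_mf r l) (i + 1) v = (\<lambda>s\<in>{..<r}. ?a s \<oplus> ?b s)"
      by (auto simp: jordan_mf_def c'_def Jv_def)
    \<comment> \<open>Coordinate \<open>s\<close> of \<open>J v\<close> and of
      \<open>J (J v)\<close>; with these names the rest is a computation with single ring
      elements.\<close>
    define w where "w = Jv s"
    define w' where "w' = ?J Jv s"
    have ww [simp]: "w \<in> carrier S" "w' \<in> carrier S" "v s \<in> carrier S"
      using Jv jordan_op_closed[OF Jv s] v s by (auto simp: w_def w'_def)
    have Jw: "?J v s = w"
      using s by (simp add: w_def Jv_def)
    have "dmap (jordan_mf r l) i (dmap (jordan_mf r l) (i + 1) v) s =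
        y \<otimes> (?a s \<oplus> ?b s) \<oplus> c \<otimes> x \<otimes> ?J (\<lambda>s\<in>{..<r}. ?a s \<oplus> ?b s) s"
      unfolding d using s by (simp add: jordan_mf_def c_def)
    also have "?J (\<lambda>s\<in>{..<r}. ?a s \<oplus> ?b s) s = y \<otimes> w \<oplus> c' \<otimes> x \<otimes> w'"
      by (simp only: jordan_op_add[OF ab s] jordan_op_lmult[OF v y_carrier s]
          jordan_op_lmult[OF Jv m_closed[OF cc(2) x_carrier] s] Jw w'_def)
    also have "y \<otimes> (?a s \<oplus> ?b s) = y \<otimes> y \<otimes> v s \<oplus> c' \<otimes> (y \<otimes> x \<otimes> w)"
    proof -
      have "y \<otimes> (c' \<otimes> x \<otimes> w) = c' \<otimes> (y \<otimes> x \<otimes> w)"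
        using scal_central[of y] by (simp add: c'_def m_assoc[symmetric])
      then show ?thesis
        using s by (simp add: r_distr m_assoc w_def[symmetric])
    qed
    \<comment> \<open>Central scalars let the two factors \<open>x\<close> meet, so the term in
      \<open>w'\<close> vanishes; the other one is rewritten by
      \<open>c = c' \<otimes> \<kappa> q\<close>.\<close>
    also have "c \<otimes> x \<otimes> (y \<otimes> w \<oplus> c' \<otimes> x \<otimes> w') = c' \<otimes> (\<kappa> q \<otimes> x \<otimes> y \<otimes> w)"
    proof -
      have "x \<otimes> (c' \<otimes> x \<otimes> w') = c' \<otimes> (x \<otimes> x \<otimes> w')"
        using scal_central[of x] by (simp add: c'_def m_assoc[symmetric])
      then have "x \<otimes> (c' \<otimes> x \<otimes> w') = \<zero>"
        by (simp add: x_sq)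
      then show ?thesis
        by (simp add: r_distr m_assoc c)
    qed
    also have "y \<otimes> y \<otimes> v s \<oplus> c' \<otimes> (y \<otimes> x \<otimes> w) \<oplus> c' \<otimes> (\<kappa> q \<otimes> x \<otimes> y \<otimes> w) =
        y \<otimes> y \<otimes> v s \<oplus> c' \<otimes> ((\<kappa> q \<otimes> x \<otimes> y \<oplus> y \<otimes> x) \<otimes> w)"
      by (simp add: l_distr r_distr a_ac)
    finally show ?thesis
      using s by (simp add: skew)
  qed
qed

text \<open>All twists at position 0 are 0, so the module there is literally the untwisted free
  module and the identity is the required isomorphism.\<close>

lemma jordan_mf_NMF0: "jordan_mf r l \<in> NMF0 S 2 (y \<otimes> y)"
proof -
  have "graded_iso S M M" for M :: "('a, nat \<Rightarrow> 'a) gr_rmod"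
    unfolding graded_iso_def
    by (rule bexI[of _ "\<lambda>v. v"], rule bexI[of _ "\<lambda>v. v"]) (auto intro: graded_hom_id)
  then show ?thesis
    using jordan_mf_graded_hom jordan_mf_square
    by (auto simp: NMF0_def NMF_def mf_mod_jordan free_mod_simps) (auto simp: jordan_mf_def)
qed

text \<open>The basis is indexed from \<open>1\<close>, so that \<open>basis r 0 = 0\<close> and the shift sends
  \<open>basis r (Suc s)\<close> to \<open>basis r s\<close> without exception.\<close>

definition basis :: "nat \<Rightarrow> nat \<Rightarrow> nat \<Rightarrow> 'a" where
  "basis r s = (\<lambda>t\<in>{..<r}. if Suc t = s then \<one> else \<zero>)"

lemma basis_carrier: "basis r s \<in> (\<Pi>\<^sub>E s\<in>{..<r}. carrier S)"
  by (auto simp: basis_def)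

lemma basis_0: "basis r 0 = (\<lambda>t\<in>{..<r}. \<zero>)"
  by (auto simp: basis_def)

text \<open>Writes the image of a basis vector as a right linear combination of basis vectors, so
  that linearity of a morphism can be applied to it. The weight at position 0 is 1, and
  \<open>basis r 0\<close> covers the first vector.\<close>

lemma dmap_basis:
  assumes "s < r"
  shows "dmap (jordan_mf r l) 0 (basis r (Suc s)) =
    (\<lambda>t\<in>{..<r}. (\<lambda>t\<in>{..<r}. basis r (Suc s) t \<otimes> (y \<oplus> x \<otimes> \<kappa> l)) t \<oplus>
      (\<lambda>t\<in>{..<r}. basis r s t \<otimes> x) t)"
  using assms
  by (auto simp: jordan_mf_def jordan_op_def jshift_def basis_def fun_eq_iff restrict_def scal_central)

section \<open>Morphisms between Jordan factorizations as scalar matrices\<close>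

text \<open>The last property says that \<open>M\<close> intertwines the two Jordan blocks, entry by
  entry. Rows are counted from 0 and columns from 1; column 0 is the image of the zero vector
  \<open>basis r 0\<close>.\<close>

lemma mf_hom_jordan:
  assumes "g \<in> mf_hom S (jordan_mf r l) (jordan_mf r m)"
  obtains M where "\<And>s t. t < r \<Longrightarrow> g 0 (basis r s) t = \<kappa> (M t s)"
    and "\<And>t. t < r \<Longrightarrow> M t 0 = 0"
    and "\<And>s t. s < r \<Longrightarrow> t < r \<Longrightarrow>
      l * M t (Suc s) + M t s = m * M t (Suc s) + (if Suc t < r then M (Suc t) (Suc s) else 0)"
proof -
  have hom: "g i \<in> graded_hom S (free_mod S r (\<lambda>_. i)) (free_mod S r (\<lambda>_. i))" for i
    using mf_homD(1)[OF assms, of i] by (simp add: mf_mod_jordan)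
  have "\<kappa> a \<in> homog S 0" for a
    by (simp add: homog_0)
  \<comment> \<open>As \<open>\<kappa> 1 = \<one>\<close> has degree 0, the basis vectors at
    position \<open>i\<close> have degree \<open>i\<close>; so do their images, whose coordinates
    therefore lie in the degree 0 part, the scalars.\<close>
  from this[of 1] have "basis r s \<in> gcomp (free_mod S r (\<lambda>_. i)) i" for s i
    by (auto simp: free_mod_simps basis_def)
  then have "g i (basis r s) \<in> gcomp (free_mod S r (\<lambda>_. i)) i" for i s
    using graded_homD(4)[OF hom] by blast
  then have ex: "t < r \<Longrightarrow> \<exists>a. g i (basis r s) t = \<kappa> a" for i s t
    by (fastforce simp: free_mod_simps homog_0 PiE_iff)
  from ex[of _ 0] obtain M where M: "\<And>s t. t < r \<Longrightarrow> g 0 (basis r s) t = \<kappa> (M t s)"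
    by metis
  from ex[of _ 1] obtain N where N: "\<And>s t. t < r \<Longrightarrow> g 1 (basis r s) t = \<kappa> (N t s)"
    by metis
  have M0: "M t 0 = 0" if "t < r" for t
  proof -
    have "\<kappa> (M t 0) = \<kappa> 0"
      using graded_hom_zero[OF hom, of 0] that by (simp flip: M add: basis_0)
    then show ?thesis
      by (simp only: scal_inj)
  qed
  \<comment> \<open>Evaluates the commuting square at position 0 on a basis vector. The coefficients
    of \<open>y\<close> identify the matrices at positions 0 and 1, those of \<open>x\<close> give
    the intertwining relation.\<close>
  have rel: "N t (Suc s) = M t (Suc s) \<and>
      m * N t (Suc s) + (if Suc t < r then N (Suc t) (Suc s) else 0) = l * M t (Suc s) + M t s"
    if s: "s < r" and t: "t < r" for s t
  proof -
    let ?F = "free_mod S r (\<lambda>_. 0)"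
    let ?b = "basis r (Suc s)" and ?b' = "basis r s"
    have b: "basis r s \<in> carrier (free_mod S r n)" for s n
      by (simp add: free_mod_simps basis_carrier)
    have c: "y \<oplus> x \<otimes> \<kappa> l \<in> carrier S"
      by simp
    have r: "ract ?F u a \<in> carrier ?F" if "u \<in> carrier ?F" "a \<in> carrier S" for u a
      using that by (auto simp: free_mod_simps)
    have "g 0 (dmap (jordan_mf r l) 0 ?b) = g 0 (madd ?F (ract ?F ?b (y \<oplus> x \<otimes> \<kappa> l)) (ract ?F ?b' x))"
      by (simp add: dmap_basis[OF s] free_mod_simps)
    also have "\<dots> = madd ?F (ract ?F (g 0 ?b) (y \<oplus> x \<otimes> \<kappa> l)) (ract ?F (g 0 ?b') x)"
      using r[OF b] c by (simp add: graded_homD(2,3)[OF hom] b)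
    finally have "g 0 (dmap (jordan_mf r l) 0 ?b) t =
        \<kappa> (M t (Suc s)) \<otimes> (y \<oplus> x \<otimes> \<kappa> l) \<oplus> \<kappa> (M t s) \<otimes> x"
      using t by (simp add: free_mod_simps M)
    \<comment> \<open>Scalars are moved to the right, the side on which \<open>indep\<close> expects
      them.\<close>
    also have "\<dots> = (y \<oplus> x \<otimes> \<kappa> l) \<otimes> \<kappa> (M t (Suc s)) \<oplus> x \<otimes> \<kappa> (M t s)"
      by (simp add: scal_central)
    also have "\<dots> = y \<otimes> \<kappa> (M t (Suc s)) \<oplus> x \<otimes> \<kappa> (l * M t (Suc s) + M t s)"
      by (simp add: scal_add scal_mult l_distr r_distr m_assoc a_assoc)
    finally have L: "g 0 (dmap (jordan_mf r l) 0 ?b) t =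
      y \<otimes> \<kappa> (M t (Suc s)) \<oplus> x \<otimes> \<kappa> (l * M t (Suc s) + M t s)" .
    have "dmap (jordan_mf r m) 0 (g 1 ?b) t =
        y \<otimes> \<kappa> (N t (Suc s)) \<oplus> x \<otimes> \<kappa> (m * N t (Suc s) + (if Suc t < r then N (Suc t) (Suc s) else 0))"
      using t by (simp add: jordan_mf_def jordan_op_def jshift_def N scal_add scal_mult r_distr)
    moreover have "g 0 (dmap (jordan_mf r l) 0 ?b) = dmap (jordan_mf r m) 0 (g 1 ?b)"
      using mf_homD(2)[OF assms, of ?b 0] b by (simp add: mf_mod_jordan)
    ultimately have "y \<otimes> \<kappa> (M t (Suc s)) \<oplus> x \<otimes> \<kappa> (l * M t (Suc s) + M t s) =
        y \<otimes> \<kappa> (N t (Suc s)) \<oplus> x \<otimes> \<kappa> (m * N t (Suc s) + (if Suc t < r then N (Suc t) (Suc s) else 0))"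
      using L by simp
    from indep[OF this] show ?thesis
      by (metis (no_types))
  qed
  \<comment> \<open>The first half of \<open>rel\<close>, in rows \<open>t\<close> and
    \<open>Suc t\<close>, replaces \<open>N\<close> by \<open>M\<close> in the second half.\<close>
  have "l * M t (Suc s) + M t s = m * M t (Suc s) + (if Suc t < r then M (Suc t) (Suc s) else 0)"
    if "s < r" "t < r" for s t
    using rel[of s t] rel[of s "Suc t"] that by (auto split: if_splits)
  with M M0 show thesis
    by (rule that)
qed

lemma graded_hom_eq_zero_if_basis:
  assumes hom: "g \<in> graded_hom S (free_mod S r m) (free_mod S r' m')"
    and basis: "\<And>s. s < r \<Longrightarrow> g (basis r (Suc s)) = (\<lambda>t\<in>{..<r'}. \<zero>)"
    and v: "v \<in> carrier (free_mod S r m)"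
  shows "g v = (\<lambda>t\<in>{..<r'}. \<zero>)"
proof -
  let ?F = "free_mod S r m"
  \<comment> \<open>Truncation of \<open>v\<close> to its first \<open>j\<close> coordinates; each
    induction step adds the multiple of one basis vector by one coordinate, until
    \<open>tr r = v\<close>.\<close>
  define tr where "tr j = (\<lambda>t\<in>{..<r}. if t < j then v t else \<zero>)" for j
  have tr: "tr j \<in> carrier ?F" for j
    using v by (simp add: tr_def free_mod_simps PiE_iff)
  have "g (tr j) = (\<lambda>t\<in>{..<r'}. \<zero>)" if "j \<le> r" for j
    using that
  proof (induction j)
    case 0
    have "tr 0 = (\<lambda>s\<in>{..<r}. \<zero>)"
      by (simp add: tr_def)
    then show ?case
      using graded_hom_zero[OF hom] by (simp only:)
  next
    case (Suc j)
    have vj: "v j \<in> carrier S"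
      using v Suc.prems by (simp add: free_mod_simps PiE_iff)
    have b: "basis r (Suc j) \<in> carrier ?F"
      by (simp add: free_mod_simps basis_carrier)
    have rb: "ract ?F (basis r (Suc j)) (v j) \<in> carrier ?F"
      using b vj by (simp add: free_mod_simps PiE_iff)
    have "tr (Suc j) = madd ?F (tr j) (ract ?F (basis r (Suc j)) (v j))"
      unfolding tr_def free_mod_simps basis_def
      by (rule restrict_ext) (use v vj in \<open>auto simp: free_mod_simps PiE_iff less_Suc_eq\<close>)
    then have "g (tr (Suc j)) = madd (free_mod S r' m') (g (tr j)) (ract (free_mod S r' m') (g (basis r (Suc j))) (v j))"
      by (simp add: graded_homD(2)[OF hom tr rb] graded_homD(3)[OF hom b vj])
    also have "\<dots> = (\<lambda>t\<in>{..<r'}. \<zero>)"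
      unfolding free_mod_simps
      by (rule restrict_ext) (use Suc basis[of j] vj in simp)
    finally show ?case .
  qed
  moreover have "tr r = v"
    using v by (auto simp: tr_def free_mod_simps fun_eq_iff PiE_iff extensional_def)
  ultimately show ?thesis
    by (metis order_refl)
qed

text \<open>An endomorphism commutes with the nilpotent shift, whose kernel in degree \<open>0\<close> is spanned by
  the first basis vector.\<close>

lemma endo_basis_Suc:
  assumes "e \<in> mf_hom S (jordan_mf r l) (jordan_mf r l)"
    and "s < r" and "e 0 (basis r s) = (\<lambda>t\<in>{..<r}. \<zero>)"
  obtains a where "e 0 (basis r (Suc s)) = (\<lambda>t\<in>{..<r}. basis r 1 t \<otimes> \<kappa> a)"
proof -
  obtain M where M: "\<And>s t. t < r \<Longrightarrow> e 0 (basis r s) t = \<kappa> (M t s)"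
    and rel: "\<And>s t. s < r \<Longrightarrow> t < r \<Longrightarrow>
      l * M t (Suc s) + M t s = l * M t (Suc s) + (if Suc t < r then M (Suc t) (Suc s) else 0)"
    using mf_hom_jordan[OF assms(1)] by metis
  have M0: "M t s = 0" if "t < r" for t
    using M[OF that, of s] assms(3) that scal_inj[of "M t s" 0] by simp
  \<comment> \<open>With equal eigenvalues the intertwining relation says that entries are constant
    along diagonals, so a zero column \<open>s\<close> leaves only row 0 free in column
    \<open>Suc s\<close>.\<close>
  have "M (Suc t) (Suc s) = 0" if "Suc t < r" for t
    using rel[of s t] M0[of t] assms(2) that by simp
  then have z: "M t (Suc s) = 0" if "t < r" "t \<noteq> 0" for t
    using that by (cases t) auto
  have hom: "e 0 \<in> graded_hom S (free_mod S r (\<lambda>_. 0)) (free_mod S r (\<lambda>_. 0))"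
    using mf_homD(1)[OF assms(1), of 0] by (simp add: mf_mod_jordan)
  have "e 0 (basis r (Suc s)) \<in> carrier (free_mod S r (\<lambda>_. 0))"
    by (rule graded_homD(1)[OF hom]) (simp add: free_mod_simps basis_carrier)
  then have "e 0 (basis r (Suc s)) \<in> extensional {..<r}"
    by (simp add: free_mod_simps PiE_iff)
  then have "e 0 (basis r (Suc s)) = (\<lambda>t\<in>{..<r}. basis r 1 t \<otimes> \<kappa> (M 0 (Suc s)))"
    by (rule extensionalityI[OF _ restrict_extensional], simp add: M z) (simp add: basis_def z)
  with that show thesis
    by blast
qed

text \<open>Induction along the basis: once one basis vector is killed, the next is sent to a
  multiple of the first basis vector. A second application kills that multiple, so by idempotence it
  was already zero.\<close>

lemma idempotent_endo_zero:
  assumes e: "e \<in> mf_hom S (jordan_mf r l) (jordan_mf r l)"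
    and idem: "\<And>v. v \<in> carrier (free_mod S r (\<lambda>_. 0)) \<Longrightarrow> e 0 (e 0 v) = e 0 v"
    and e1: "e 0 (basis r 1) = (\<lambda>t\<in>{..<r}. \<zero>)"
    and v: "v \<in> carrier (free_mod S r (\<lambda>_. 0))"
  shows "e 0 v = (\<lambda>t\<in>{..<r}. \<zero>)"
proof (rule graded_hom_eq_zero_if_basis[OF _ _ v])
  show hom: "e 0 \<in> graded_hom S (free_mod S r (\<lambda>_. 0)) (free_mod S r (\<lambda>_. 0))"
    using mf_homD(1)[OF e, of 0] by (simp add: mf_mod_jordan)
  have b: "basis r s \<in> carrier (free_mod S r (\<lambda>_. 0))" for s
    by (simp add: free_mod_simps basis_carrier)
  have "e 0 (basis r s) = (\<lambda>t\<in>{..<r}. \<zero>)" if "s \<le> r" for s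
    using that
  proof (induction s)
    case 0
    show ?case
      unfolding basis_0 by (rule graded_hom_zero[OF hom])
  next
    case (Suc s)
    then have "s < r"
      by simp
    moreover have "e 0 (basis r s) = (\<lambda>t\<in>{..<r}. \<zero>)"
      by (rule Suc.IH) (use Suc.prems in simp)
    ultimately obtain a where a: "e 0 (basis r (Suc s)) = (\<lambda>t\<in>{..<r}. basis r 1 t \<otimes> \<kappa> a)"
      by (rule endo_basis_Suc[OF e])
    then have "e 0 (basis r (Suc s)) = e 0 (ract (free_mod S r (\<lambda>_. 0)) (basis r 1) (\<kappa> a))"
      using idem[OF b, of "Suc s"] by (simp add: free_mod_simps)
    also have "\<dots> = (\<lambda>t\<in>{..<r}. \<zero>)"
      unfolding graded_homD(3)[OF hom b scal_closed] e1 by (auto simp: free_mod_simps)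
    finally show ?case .
  qed
  then show "e 0 (basis r (Suc s)) = (\<lambda>t\<in>{..<r}. \<zero>)" if "s < r" for s
    using that by simp
qed

text \<open>The first basis vector is an eigenvector of every endomorphism, by
  \<open>endo_basis_Suc\<close> at \<open>s = 0\<close>. Idempotence forces \<open>a * a = a\<close>
  for its eigenvalue, hence \<open>a\<close> is 0 or 1 in the field.\<close>

lemma idempotent_endo_basis_1:
  assumes e: "e \<in> mf_hom S (jordan_mf r l) (jordan_mf r l)"
    and idem: "e 0 (e 0 (basis r 1)) = e 0 (basis r 1)"
    and r: "r \<ge> 1"
  shows "e 0 (basis r 1) = (\<lambda>t\<in>{..<r}. \<zero>) \<or> e 0 (basis r 1) = basis r 1"
proof -
  have hom: "e 0 \<in> graded_hom S (free_mod S r (\<lambda>_. 0)) (free_mod S r (\<lambda>_. 0))"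
    using mf_homD(1)[OF e, of 0] by (simp add: mf_mod_jordan)
  have b: "basis r 1 \<in> carrier (free_mod S r (\<lambda>_. 0))"
    by (simp add: free_mod_simps basis_carrier)
  have "0 < r"
    using r by simp
  moreover have "e 0 (basis r 0) = (\<lambda>t\<in>{..<r}. \<zero>)"
    unfolding basis_0 by (rule graded_hom_zero[OF hom])
  ultimately obtain a where "e 0 (basis r (Suc 0)) = (\<lambda>t\<in>{..<r}. basis r 1 t \<otimes> \<kappa> a)"
    by (rule endo_basis_Suc[OF e])
  then have a: "e 0 (basis r 1) = (\<lambda>t\<in>{..<r}. basis r 1 t \<otimes> \<kappa> a)"
    by (simp only: One_nat_def)
  have "e 0 (basis r 1) = e 0 (ract (free_mod S r (\<lambda>_. 0)) (basis r 1) (\<kappa> a))"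
    using idem a by (simp add: free_mod_simps)
  also have "\<dots> = (\<lambda>t\<in>{..<r}. basis r 1 t \<otimes> \<kappa> a \<otimes> \<kappa> a)"
    unfolding graded_homD(3)[OF hom b scal_closed] a by (auto simp: free_mod_simps fun_eq_iff)
  finally have "(\<lambda>t\<in>{..<r}. basis r 1 t \<otimes> \<kappa> a \<otimes> \<kappa> a) 0 = (\<lambda>t\<in>{..<r}. basis r 1 t \<otimes> \<kappa> a) 0"
    using a by simp
  then have "\<kappa> (a * a) = \<kappa> a"
    using r by (simp add: basis_def scal_mult)
  then have "a = 0 \<or> a = 1"
    by (simp add: scal_inj)
  then show ?thesis
    unfolding a by (auto simp: basis_def fun_eq_iff restrict_def)
qed

section \<open>Indecomposability, and separation by the eigenvalue\<close>

text \<open>A splitting transports the two summand projections to idempotent endomorphisms. Each of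
  them kills or fixes the first basis vector, and the two cannot both fix it; one that kills it is
  zero at position 0, which makes its summand trivial.\<close>

lemma jordan_mf_indecomposable:
  assumes r: "r \<ge> 1"
  shows "indecomposable S (NMF0 S 2 (y \<otimes> y)) (jordan_mf r l)"
  unfolding indecomposable_def
proof (intro conjI ballI impI)
  show "jordan_mf r l \<in> NMF0 S 2 (y \<otimes> y)"
    by (rule jordan_mf_NMF0)
  have "basis r 1 \<in> carrier (mf_mod S (jordan_mf r l) 0)"
    by (simp add: mf_mod_jordan free_mod_simps basis_carrier)
  moreover have "basis r 1 0 \<noteq> mzero (mf_mod S (jordan_mf r l) 0) 0"
    using r one_neq_zero by (simp add: mf_mod_jordan free_mod_simps basis_def)
  ultimately show "\<not> mf_zero S (jordan_mf r l)"
    unfolding mf_zero_def by (metis singletonD)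
next
  fix P Q
  assume "P \<in> NMF0 S 2 (y \<otimes> y)" "Q \<in> NMF0 S 2 (y \<otimes> y)"
  then have PQ: "P \<in> NMF S 2 (y \<otimes> y)" "Q \<in> NMF S 2 (y \<otimes> y)"
    by (simp_all add: NMF0_def)
  let ?J = "jordan_mf r l" and ?F = "free_mod S r (\<lambda>_. 0)"
  let ?G = "mf_mod S (mf_sum P Q) 0"
  assume "mf_iso S ?J (mf_sum P Q)"
  then obtain g h where g: "g \<in> mf_hom S ?J (mf_sum P Q)" and h: "h \<in> mf_hom S (mf_sum P Q) ?J"
    and gh: "\<And>u. u \<in> carrier ?G \<Longrightarrow> g 0 (h 0 u) = u"
    unfolding mf_iso_def by blast
  define pr where "pr = summand_proj (rk P) (rk Q)"
  \<comment> \<open>The projection onto one summand, conjugated by the isomorphism.\<close>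
  define e where "e b i v = h i (pr b (g i v))" for b i v
  have pr: "(\<lambda>_. pr b) \<in> mf_hom S (mf_sum P Q) (mf_sum P Q)" for b
    unfolding pr_def by (rule summand_proj_mf_hom[OF PQ])
  have e: "e b \<in> mf_hom S ?J ?J" for b
    unfolding e_def using mf_hom_comp[OF mf_hom_comp[OF g pr] h] by simp
  have G: "g 0 v \<in> carrier ?G" if "v \<in> carrier ?F" for v
    using graded_homD(1)[OF mf_homD(1)[OF g]] that by (simp add: mf_mod_jordan)
  have prG: "pr b v \<in> carrier ?G" if "v \<in> carrier ?G" for v b
    using graded_homD(1)[OF mf_homD(1)[OF pr]] that by blast
  have hF: "h 0 v \<in> carrier ?F" if "v \<in> carrier ?G" for v
    using graded_homD(1)[OF mf_homD(1)[OF h]] that by (simp add: mf_mod_jordan)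
  have prpr: "pr b (pr b v) = pr b v" for b v
    by (auto simp: pr_def summand_proj_def fun_eq_iff restrict_def)
  have idem: "e b 0 (e b 0 v) = e b 0 v" if "v \<in> carrier ?F" for b v
    using that by (simp add: e_def gh G prG prpr)
  let ?b = "basis r 1"
  have b: "?b \<in> carrier ?F"
    by (simp add: free_mod_simps basis_carrier)
  have gz: "g 0 (\<lambda>t\<in>{..<r}. \<zero>) = (\<lambda>s\<in>{..<rk P + rk Q}. \<zero>)"
    using mf_homD(1)[OF g, of 0] unfolding mf_mod_jordan
    by (intro graded_hom_zero) (simp add: mf_mod_def mf_sum_def)
  have zero: "mf_zero S (if b then P else Q)" if eb: "e b 0 ?b = (\<lambda>t\<in>{..<r}. \<zero>)" for b
  proof (rule mf_zero_if_summand_proj_zero[OF one_neq_zero])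
    fix v assume v: "v \<in> carrier (mf_mod S (mf_sum P Q) 0)"
    \<comment> \<open>Since \<open>g 0\<close> inverts \<open>h 0\<close>, the projection is
      recovered from the endomorphism and vanishes with it.\<close>
    have "pr b v = g 0 (e b 0 (h 0 v))"
      using v by (simp add: e_def gh prG)
    also have "\<dots> = g 0 (\<lambda>t\<in>{..<r}. \<zero>)"
      using idempotent_endo_zero[OF e idem eb hF[OF v]] by simp
    also have "\<dots> = (\<lambda>s\<in>{..<rk P + rk Q}. \<zero>)"
      by (rule gz)
    finally show "summand_proj (rk P) (rk Q) b v = (\<lambda>s\<in>{..<rk P + rk Q}. \<zero>)"
      by (simp add: pr_def)
  qed
  show "mf_zero S P \<or> mf_zero S Q"
  proof (cases "e True 0 ?b = (\<lambda>t\<in>{..<r}. \<zero>)")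
    case True
    with zero[of True] show ?thesis
      by simp
  next
    case False
    \<comment> \<open>In the other case \<open>g 0 ?b\<close> lies in the first summand, so the
      complementary projection kills it.\<close>
    then have "e True 0 ?b = ?b"
      using idempotent_endo_basis_1[OF e idem[OF b] r] by blast
    then have "pr True (g 0 ?b) = g 0 ?b"
      using gh[OF prG[OF G[OF b]], of True] by (simp add: e_def)
    then have "pr False (g 0 ?b) = pr False (pr True (g 0 ?b))"
      by simp
    also have "\<dots> = pr False (g 0 (\<lambda>t\<in>{..<r}. \<zero>))"
      by (auto simp: gz pr_def summand_proj_def)
    finally have "e False 0 ?b = e False 0 (\<lambda>t\<in>{..<r}. \<zero>)"
      by (simp add: e_def)
    also have "\<dots> = (\<lambda>t\<in>{..<r}. \<zero>)"
      using mf_homD(1)[OF e, of False 0] unfolding mf_mod_jordan by (rule graded_hom_zero)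
    finally show ?thesis
      using zero[of False] by simp
  qed
qed

text \<open>For different eigenvalues the first column of an intertwining matrix vanishes, so a
  morphism kills the first basis vector and cannot be injective.\<close>

lemma jordan_mf_iso_imp_eq:
  assumes r: "r \<ge> 1" and iso: "mf_iso S (jordan_mf r l) (jordan_mf r m)"
  shows "l = m"
proof (rule ccontr)
  assume lm: "l \<noteq> m"
  let ?F = "free_mod S r (\<lambda>_. 0)"
  obtain g h where g: "g \<in> mf_hom S (jordan_mf r l) (jordan_mf r m)"
    and h: "h \<in> mf_hom S (jordan_mf r m) (jordan_mf r l)"
    and "\<forall>i. \<forall>u\<in>carrier (mf_mod S (jordan_mf r l) i). h i (g i u) = u"
    using iso unfolding mf_iso_def by blast
  then have hg: "h 0 (g 0 u) = u" if "u \<in> carrier ?F" for u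
    using that by (simp add: mf_mod_jordan)
  obtain M where M: "\<And>s t. t < r \<Longrightarrow> g 0 (basis r s) t = \<kappa> (M t s)"
    and M0: "\<And>t. t < r \<Longrightarrow> M t 0 = 0"
    and rel: "\<And>s t. s < r \<Longrightarrow> t < r \<Longrightarrow>
      l * M t (Suc s) + M t s = m * M t (Suc s) + (if Suc t < r then M (Suc t) (Suc s) else 0)"
    using mf_hom_jordan[OF g] by metis
  have M1: "M t 1 = 0" if "t < r" for t
    using that
  \<comment> \<open>Descends from the last row: below it the relation has no further entry, and
    \<open>M t 0 = 0\<close> leaves \<open>l * M t 1 = m * M t 1\<close>.\<close>
  proof (induction "r - t" arbitrary: t)
    case (Suc k)
    have "(if Suc t < r then M (Suc t) 1 else 0) = 0"
      using Suc.hyps(1)[of "Suc t"] Suc.hyps(2) by auto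
    then have "l * M t 1 = m * M t 1"
      using rel[of 0 t] M0[OF Suc.prems] Suc.prems by (auto split: if_splits)
    then show ?case
      using lm by simp
  qed simp
  have b: "basis r 1 \<in> carrier ?F"
    by (simp add: free_mod_simps basis_carrier)
  have hom: "g 0 \<in> graded_hom S ?F ?F" "h 0 \<in> graded_hom S ?F ?F"
    using mf_homD(1)[OF g, of 0] mf_homD(1)[OF h, of 0] by (simp_all add: mf_mod_jordan)
  have "g 0 (basis r 1) \<in> carrier ?F"
    by (rule graded_homD(1)[OF hom(1) b])
  then have "g 0 (basis r 1) = (\<lambda>t\<in>{..<r}. \<zero>)"
    using M[of _ 1] M1 by (auto simp: free_mod_simps fun_eq_iff PiE_iff extensional_def)
  then have "basis r 1 = (\<lambda>t\<in>{..<r}. \<zero>)"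
    using hg[OF b] graded_hom_zero[OF hom(2)] by simp
  then have "basis r 1 0 = (\<lambda>t\<in>{..<r}. \<zero>) 0"
    by simp
  then show False
    using r one_neq_zero by (simp add: basis_def)
qed

text \<open>The eigenvalue embeds the field into the set of classes. By reflexivity each
  factorization lies in its own class, so equal classes yield an isomorphism and hence equal
  eigenvalues.\<close>

theorem infinite_iso_classes:
  assumes "infinite (UNIV :: 'k set)" and r: "r \<ge> 1"
  shows "infinite (iso_classes S {P. indecomposable S (NMF0 S 2 (y \<otimes> y)) P \<and> rk P = r})"
proof -
  let ?C = "{P. indecomposable S (NMF0 S 2 (y \<otimes> y)) P \<and> rk P = r}"
  let ?R = "{(P, Q). P \<in> ?C \<and> Q \<in> ?C \<and> mf_iso S P Q}"
  let ?cl = "\<lambda>l. ?R `` {jordan_mf r l}"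
  have C: "jordan_mf r l \<in> ?C" for l
    using jordan_mf_indecomposable[OF r] by (simp add: jordan_mf_def)
  have "inj ?cl"
  proof (rule injI)
    fix l m assume "?cl l = ?cl m"
    moreover have "jordan_mf r m \<in> ?cl m"
      using C[of m] by (simp add: mf_iso_refl)
    ultimately have "jordan_mf r m \<in> ?cl l"
      by (simp only:)
    then have "mf_iso S (jordan_mf r l) (jordan_mf r m)"
      by simp
    then show "l = m"
      by (rule jordan_mf_iso_imp_eq[OF r])
  qed
  then have "infinite (range ?cl)"
    using assms(1) finite_imageD by blast
  moreover have "range ?cl \<subseteq> ?C // ?R"
    using C by (intro image_subsetI quotientI)
  ultimately show ?thesis
    unfolding iso_classes_def using finite_subset by blast
qed

end

section \<open>The algebra \<open>S\<close>\<close>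

lemma ring_extend_simps:
  "carrier (ring.extend R m) = carrier R"
  "monoid.mult (ring.extend R m) = monoid.mult R"
  "\<one>\<^bsub>ring.extend R m\<^esub> = \<one>\<^bsub>R\<^esub>"
  "\<zero>\<^bsub>ring.extend R m\<^esub> = \<zero>\<^bsub>R\<^esub>"
  "add (ring.extend R m) = add R"
  by (simp_all add: ring.defs)

lemma ring_extend:
  assumes "ring R"
  shows "ring (ring.extend R m)"
proof -
  interpret R: ring R
    by fact
  show ?thesis
    by (intro ringI abelian_groupI monoidI)
      (auto simp: ring_extend_simps R.a_ac R.m_assoc R.l_distr R.r_distr
        intro: R.add.l_inv_ex)
qed

lemma free_algebra_simps:
  "monoid.mult (free_algebra n) = (*)"
  "\<one>\<^bsub>free_algebra n\<^esub> = 1"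
  "\<zero>\<^bsub>free_algebra n\<^esub> = 0"
  "add (free_algebra n) = (+)"
  by (simp_all add: free_algebra_def)

lemma fconst_closed [simp]: "fconst c \<in> carrier (free_algebra n)"
  by (simp add: carrier_free_algebra fconst_def)

lemma fvar_closed [simp]: "i \<in> {1..n} \<Longrightarrow> fvar i \<in> carrier (free_algebra n)"
  by (simp add: carrier_free_algebra fvar_def)

lemma free_algebra_mult_closed:
  "p \<in> carrier (free_algebra n) \<Longrightarrow> p' \<in> carrier (free_algebra n) \<Longrightarrow> p * p' \<in> carrier (free_algebra n)"
  using monoid.m_closed[OF ring.is_monoid[OF ring_free_algebra]] by (metis free_algebra_simps(1))

lemma free_algebra_add_closed:
  "p \<in> carrier (free_algebra n) \<Longrightarrow> p' \<in> carrier (free_algebra n) \<Longrightarrow> p + p' \<in> carrier (free_algebra n)"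
  using keys_add[of p p'] by (auto simp: carrier_free_algebra)

text \<open>Constants sit on the empty word, which is neutral for concatenation, and the field is
  commutative; the induction adds one monomial at a time.\<close>

lemma fconst_central: "p * fconst c = fconst c * p"
proof (induction p rule: update_induct)
  case (update p w a)
  \<comment> \<open>The word \<open>w\<close> is outside the support of \<open>p\<close>, so the
    update is a sum.\<close>
  have "Poly_Mapping.update w a p = p + Poly_Mapping.single w a"
    using update.hyps(1)
    by (intro poly_mapping_eqI) (auto simp: lookup_update lookup_add lookup_single when_def in_keys_iff)
  moreover have "Poly_Mapping.single w a * fconst c = fconst c * Poly_Mapping.single w a"
    by (simp add: fconst_def mult_single plus_list_def mult.commute)
  ultimately show ?case
    by (simp add: algebra_simps update.IH)
qed simp

section \<open>The quotient maps and their injectivity in degrees 0 and 1\<close>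

text \<open>The \<open>d\<close>-th power of the ideal generated by the variables. For
  \<open>d = 2\<close> it bounds both defining ideals and shows that the quotients lose nothing in
  degrees 0 and 1.\<close>

definition min_length :: "nat \<Rightarrow> nat \<Rightarrow> (nat list \<Rightarrow>\<^sub>0 'k::field) set" where
  "min_length n d = {p \<in> carrier (free_algebra n). \<forall>w\<in>Poly_Mapping.keys p. d \<le> length w}"

lemma ideal_min_length: "ideal (min_length n d :: (nat list \<Rightarrow>\<^sub>0 'k::field) set) (free_algebra n)"
proof -
  interpret F: ring "free_algebra n :: (nat list \<Rightarrow>\<^sub>0 'k) ring"
    by (rule ring_free_algebra)
  let ?I = "min_length n d :: (nat list \<Rightarrow>\<^sub>0 'k) set"
  have inv: "\<ominus>\<^bsub>free_algebra n\<^esub> p = - p" if "p \<in> carrier (free_algebra n)" for p :: "nat list \<Rightarrow>\<^sub>0 'k"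
    using that by (intro F.minus_equality) (auto simp: free_algebra_simps carrier_free_algebra)
  show ?thesis
  proof (rule idealI)
    show "subgroup ?I (add_monoid (free_algebra n))"
    proof (rule F.add.subgroupI)
      show "?I \<subseteq> carrier (free_algebra n)"
        by (auto simp: min_length_def)
      show "?I \<noteq> {}"
        using F.zero_closed by (auto simp: min_length_def free_algebra_simps intro!: exI[of _ 0])
      show "\<ominus>\<^bsub>free_algebra n\<^esub> p \<in> ?I" if "p \<in> ?I" for p
      proof -
        have "p \<in> carrier (free_algebra n)"
          using that by (simp add: min_length_def)
        from inv[OF this] show ?thesis
          using that by (simp add: min_length_def carrier_free_algebra)
      qed
      show "p \<oplus>\<^bsub>free_algebra n\<^esub> p' \<in> ?I" if "p \<in> ?I" "p' \<in> ?I" for p p'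
        using that keys_add[of p p'] free_algebra_add_closed[of p n p']
        by (auto simp: min_length_def free_algebra_simps)
    qed
  next
    fix p a :: "nat list \<Rightarrow>\<^sub>0 'k"
    assume p: "p \<in> ?I" and a: "a \<in> carrier (free_algebra n)"
    show "a \<otimes>\<^bsub>free_algebra n\<^esub> p \<in> ?I"
      using p a keys_mult[of a p] free_algebra_mult_closed[of a n p]
      by (fastforce simp: min_length_def free_algebra_simps plus_list_def)
    show "p \<otimes>\<^bsub>free_algebra n\<^esub> a \<in> ?I"
      using p a keys_mult[of p a] free_algebra_mult_closed[of p n a]
      by (fastforce simp: min_length_def free_algebra_simps plus_list_def)
  qed (rule ring_free_algebra)
qed

lemma fvar_mult: "fvar i * fvar j = Poly_Mapping.single [i, j] 1"
  by (simp add: fvar_def mult_single plus_list_def)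

lemma skew_rels_subset: "skew_rels n \<alpha> \<subseteq> min_length n 2"
proof
  fix p assume "p \<in> skew_rels n \<alpha>"
  then obtain i j where ij: "i \<in> {1..n}" "j \<in> {1..n}"
    and p: "p = fconst (\<alpha> i j) * fvar i * fvar j + fvar j * fvar i"
    by (auto simp: skew_rels_def)
  have "p = Poly_Mapping.single [i, j] (\<alpha> i j) + Poly_Mapping.single [j, i] 1"
    by (simp add: p mult.assoc fvar_mult) (simp add: fconst_def mult_single plus_list_def)
  then have "Poly_Mapping.keys p \<subseteq> {[i, j], [j, i]}"
    using keys_add[of "Poly_Mapping.single [i, j] (\<alpha> i j)" "Poly_Mapping.single [j, i] 1"]
    by (auto split: if_splits)
  then show "p \<in> min_length n 2"
    using ij by (auto simp: min_length_def carrier_free_algebra)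
qed

lemma ideal_skew_ideal: "ideal (skew_ideal n \<alpha>) (free_algebra n)"
  unfolding skew_ideal_def
  using skew_rels_subset[of n \<alpha>]
  by (intro ring.genideal_ideal[OF ring_free_algebra]) (auto simp: min_length_def)

lemma skew_ideal_subset: "skew_ideal n \<alpha> \<subseteq> min_length n 2"
  unfolding skew_ideal_def
  by (rule ring.genideal_minimal[OF ring_free_algebra ideal_min_length skew_rels_subset])

lemma proj_T_hom: "proj_T n \<alpha> \<in> ring_hom (free_algebra n) (skew_T n \<alpha>)"
  using ideal.rcos_ring_hom[OF ideal_skew_ideal] by (simp add: proj_T_def[abs_def] skew_T_def)

lemma skew_rels_in_ideal: "skew_rels n \<alpha> \<subseteq> skew_ideal n \<alpha>"
  unfolding skew_ideal_def
  using skew_rels_subset[of n \<alpha>]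
  by (intro ring.genideal_self[OF ring_free_algebra]) (auto simp: min_length_def)

lemma squares_closed:
  fixes \<alpha> :: "nat \<Rightarrow> nat \<Rightarrow> 'k::field"
  shows "{proj_T n \<alpha> (fvar i) \<otimes>\<^bsub>skew_T n \<alpha>\<^esub> proj_T n \<alpha> (fvar i) | i. i \<in> {1..n-1}} \<subseteq>
    proj_T n \<alpha> ` min_length n 2"
proof -
  have "proj_T n \<alpha> (fvar i) \<otimes>\<^bsub>skew_T n \<alpha>\<^esub> proj_T n \<alpha> (fvar i) \<in> proj_T n \<alpha> ` min_length n 2"
    if "i \<in> {1..n-1}" for i
  proof -
    have i: "i \<in> {1..n}"
      using that by auto
    have "proj_T n \<alpha> (fvar i) \<otimes>\<^bsub>skew_T n \<alpha>\<^esub> proj_T n \<alpha> (fvar i) = proj_T n \<alpha> (fvar i * fvar i)"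
      using ring_hom_mult[OF proj_T_hom fvar_closed[OF i] fvar_closed[OF i], of \<alpha>]
      by (simp add: free_algebra_simps)
    moreover have "fvar i * fvar i \<in> (min_length n 2 :: (nat list \<Rightarrow>\<^sub>0 'k) set)"
      using i by (simp add: fvar_mult min_length_def carrier_free_algebra)
    ultimately show ?thesis
      by simp
  qed
  then show ?thesis
    by auto
qed

text \<open>The quotient map is surjective and therefore carries ideals to ideals.\<close>

lemma min_length_image_ideal: "ideal (proj_T n \<alpha> ` min_length n 2) (skew_T n \<alpha>)"
  using ring.ring_ideal_imp_quot_ideal[OF ring_free_algebra ideal_skew_ideal ideal_min_length]
  by (simp add: proj_T_def[abs_def] skew_T_def)

lemma squares_in_carrier:
  "{proj_T n \<alpha> (fvar i) \<otimes>\<^bsub>skew_T n \<alpha>\<^esub> proj_T n \<alpha> (fvar i) | i. i \<in> {1..n-1}} \<subseteq> carrier (skew_T n \<alpha>)"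
  using squares_closed ideal.Icarr[OF min_length_image_ideal] by blast

lemma ideal_square_ideal: "ideal (square_ideal n \<alpha>) (skew_T n \<alpha>)"
  unfolding square_ideal_def
  by (rule ring.genideal_ideal[OF ring_skew_T squares_in_carrier])

lemma square_ideal_subset: "square_ideal n \<alpha> \<subseteq> proj_T n \<alpha> ` min_length n 2"
  unfolding square_ideal_def
  by (rule ring.genideal_minimal[OF ring_skew_T min_length_image_ideal squares_closed])

lemma square_in_ideal:
  "i \<in> {1..n-1} \<Longrightarrow> proj_T n \<alpha> (fvar i) \<otimes>\<^bsub>skew_T n \<alpha>\<^esub> proj_T n \<alpha> (fvar i) \<in> square_ideal n \<alpha>"
  unfolding square_ideal_def
  using ring.genideal_self[OF ring_skew_T squares_in_carrier] by blast

lemma skew_S_simps: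
  "carrier (skew_S n \<alpha>) = carrier (skew_T n \<alpha> Quot square_ideal n \<alpha>)"
  "monoid.mult (skew_S n \<alpha>) = monoid.mult (skew_T n \<alpha> Quot square_ideal n \<alpha>)"
  "\<one>\<^bsub>skew_S n \<alpha>\<^esub> = \<one>\<^bsub>skew_T n \<alpha> Quot square_ideal n \<alpha>\<^esub>"
  "\<zero>\<^bsub>skew_S n \<alpha>\<^esub> = square_ideal n \<alpha>"
  "add (skew_S n \<alpha>) = add (skew_T n \<alpha> Quot square_ideal n \<alpha>)"
  "homog (skew_S n \<alpha>) d = proj_S n \<alpha> ` fhomog n d"
  by (simp_all add: skew_S_def ring_extend_simps FactRing_def) (simp add: ring.defs gr_ring.defs)

lemma ring_skew_S: "ring (skew_S n \<alpha>)"
  unfolding skew_S_def by (rule ring_extend[OF ideal.quotient_is_ring[OF ideal_square_ideal]])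

lemma proj_S_hom: "proj_S n \<alpha> \<in> ring_hom (free_algebra n) (skew_S n \<alpha>)"
proof -
  have "proj_S n \<alpha> = (+>\<^bsub>skew_T n \<alpha>\<^esub>) (square_ideal n \<alpha>) \<circ> proj_T n \<alpha>"
    by (simp add: proj_S_def fun_eq_iff)
  then have "proj_S n \<alpha> \<in> ring_hom (free_algebra n) (skew_T n \<alpha> Quot square_ideal n \<alpha>)"
    using ring_hom_trans[OF proj_T_hom ideal.rcos_ring_hom[OF ideal_square_ideal]] by simp
  then show ?thesis
    by (simp add: ring_hom_def skew_S_simps)
qed

lemma carrier_skew_S: "carrier (skew_S n \<alpha>) = proj_S n \<alpha> ` carrier (free_algebra n)"
  by (auto simp: skew_S_simps skew_T_def FactRing_def A_RCOSETS_def' proj_S_def proj_T_def)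

lemma proj_S_eq_zero:
  assumes "proj_T n \<alpha> p \<in> square_ideal n \<alpha>"
  shows "proj_S n \<alpha> p = \<zero>\<^bsub>skew_S n \<alpha>\<^esub>"
proof -
  interpret I: ideal "square_ideal n \<alpha>" "skew_T n \<alpha>"
    by (rule ideal_square_ideal)
  show ?thesis
    unfolding proj_S_def skew_S_simps using assms by (rule I.a_rcos_const)
qed

text \<open>Modulo the skew relations, \<open>p\<close> agrees with an element supported on words of
  length at least 2; the skew ideal is itself supported there, so \<open>p\<close> is too.\<close>

lemma proj_S_eq_zeroD:
  assumes p: "p \<in> carrier (free_algebra n)" and z: "proj_S n \<alpha> p = \<zero>\<^bsub>skew_S n \<alpha>\<^esub>"
  shows "p \<in> min_length n 2"
proof -
  interpret I: ideal "square_ideal n \<alpha>" "skew_T n \<alpha>"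
    by (rule ideal_square_ideal)
  interpret J: ideal "skew_ideal n \<alpha>" "free_algebra n"
    by (rule ideal_skew_ideal)
  interpret K: ideal "min_length n 2" "free_algebra n"
    by (rule ideal_min_length)
  \<comment> \<open>A representative lies in its own coset, here the ideal itself.\<close>
  have "proj_T n \<alpha> p \<in> square_ideal n \<alpha>"
    using I.a_rcos_self[OF ring_hom_closed[OF proj_T_hom p]] z
    by (simp add: proj_S_def skew_S_simps)
  then obtain q where q: "q \<in> min_length n 2" "proj_T n \<alpha> p = proj_T n \<alpha> q"
    using square_ideal_subset by blast
  then have "p \<in> skew_ideal n \<alpha> +>\<^bsub>free_algebra n\<^esub> q"
    using J.a_rcos_self[OF p] by (simp add: proj_T_def)
  then obtain a where "a \<in> skew_ideal n \<alpha>" "p = a \<oplus>\<^bsub>free_algebra n\<^esub> q"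
    by (auto simp: a_r_coset_def')
  then show ?thesis
    using q(1) skew_ideal_subset K.a_closed by blast
qed

text \<open>Coefficients of words of length below 2 are well defined on the quotient; this is the
  source of the linear independence of \<open>x\<close> and \<open>y\<close>.\<close>

lemma proj_S_eqD:
  assumes p: "p \<in> carrier (free_algebra n)" "p' \<in> carrier (free_algebra n)"
    and eq: "proj_S n \<alpha> p = proj_S n \<alpha> p'" and w: "length w < 2"
  shows "Poly_Mapping.lookup p w = Poly_Mapping.lookup p' w"
proof -
  have m: "- p' \<in> carrier (free_algebra n)"
    using p(2) by (simp add: carrier_free_algebra)
  have "proj_S n \<alpha> (p + - p') = proj_S n \<alpha> (p' + - p')"
    using ring_hom_add[OF proj_S_hom p(1) m, of \<alpha>] ring_hom_add[OF proj_S_hom p(2) m, of \<alpha>] eq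
    by (simp only: free_algebra_simps)
  also have "\<dots> = \<zero>\<^bsub>skew_S n \<alpha>\<^esub>"
    using ring_hom_zero[OF proj_S_hom ring_free_algebra ring_skew_S, of n \<alpha>]
    by (simp add: free_algebra_simps)
  finally have "p + - p' \<in> min_length n 2"
    by (rule proj_S_eq_zeroD[OF free_algebra_add_closed[OF p(1) m]])
  then have "w \<notin> Poly_Mapping.keys (p + - p')"
    using w by (auto simp: min_length_def)
  then show ?thesis
    by (simp add: in_keys_iff lookup_minus)
qed

section \<open>Homogeneous parts and the passage to the skew algebra\<close>

lemma fhomog_0: "fhomog n 0 = range fconst"
proof (intro Set.set_eqI iffI)
  fix p assume "p \<in> fhomog n 0"
  then have "Poly_Mapping.keys p \<subseteq> {[]}"
    by (auto simp: fhomog_def)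
  then have "p = fconst (Poly_Mapping.lookup p [])"
    by (intro poly_mapping_eqI) (auto simp: fconst_def lookup_single when_def in_keys_iff)
  then show "p \<in> range fconst"
    by blast
qed (auto simp: fhomog_def fconst_def carrier_free_algebra split: if_splits)

lemma fhomog_mult: "p \<in> fhomog n i \<Longrightarrow> p' \<in> fhomog n j \<Longrightarrow> p * p' \<in> fhomog n (i + j)"
  using keys_mult[of p p'] free_algebra_mult_closed[of p n p']
  by (fastforce simp: fhomog_def plus_list_def)

lemma fhomog_add: "p \<in> fhomog n i \<Longrightarrow> p' \<in> fhomog n i \<Longrightarrow> p + p' \<in> fhomog n i"
  using keys_add[of p p'] free_algebra_add_closed[of p n p']
  by (auto simp: fhomog_def)

lemma fhomog_closed: "p \<in> fhomog n i \<Longrightarrow> p \<in> carrier (free_algebra n)"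
  by (simp add: fhomog_def)

lemma fvar_homog: "i \<in> {1..n} \<Longrightarrow> fvar i \<in> fhomog n 1"
  by (simp add: fhomog_def carrier_free_algebra fvar_def)

text \<open>As \<open>n \<ge> 2\<close>, the index 1 differs from \<open>n\<close> and lies in
  \<open>{1..n-1}\<close>: the square of the first variable is killed, and the defining relation for
  the pair \<open>1\<close>, \<open>n\<close> is literally the one required.\<close>

lemma jordan_setup_skew_S:
  fixes \<alpha> :: "nat \<Rightarrow> nat \<Rightarrow> 'k::field"
  assumes n: "n \<ge> 2" and \<alpha>: "\<alpha> 1 n \<noteq> 0"
  shows "jordan_setup (skew_S n \<alpha>) (\<lambda>a. proj_S n \<alpha> (fconst a)) (x_S n \<alpha> 1) (x_S n \<alpha> n) (\<alpha> 1 n)"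
proof -
  interpret S: ring "skew_S n \<alpha>"
    by (rule ring_skew_S)
  let ?F = "free_algebra n :: (nat list \<Rightarrow>\<^sub>0 'k) ring"
  let ?p = "proj_S n \<alpha>"
  have mult: "?p (p * p') = ?p p \<otimes>\<^bsub>skew_S n \<alpha>\<^esub> ?p p'" if "p \<in> carrier ?F" "p' \<in> carrier ?F" for p p'
    using ring_hom_mult[OF proj_S_hom that] by (simp add: free_algebra_simps)
  have add: "?p (p + p') = ?p p \<oplus>\<^bsub>skew_S n \<alpha>\<^esub> ?p p'" if "p \<in> carrier ?F" "p' \<in> carrier ?F" for p p'
    using ring_hom_add[OF proj_S_hom that] by (simp add: free_algebra_simps)
  have zero: "?p 0 = \<zero>\<^bsub>skew_S n \<alpha>\<^esub>"
    using ring_hom_zero[OF proj_S_hom ring_free_algebra ring_skew_S, of n \<alpha>]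
    by (simp add: free_algebra_simps)
  have one: "?p 1 = \<one>\<^bsub>skew_S n \<alpha>\<^esub>"
    using ring_hom_one[OF proj_S_hom, of n \<alpha>] by (simp add: free_algebra_simps)
  have v: "fvar 1 \<in> carrier ?F" "fvar n \<in> carrier ?F"
    using n by simp_all
  note closed = v fconst_closed free_algebra_mult_closed free_algebra_add_closed
  show ?thesis
  proof unfold_locales
    fix u v i j
    show "u \<in> homog (skew_S n \<alpha>) i \<Longrightarrow> u \<in> carrier (skew_S n \<alpha>)"
      using fhomog_closed by (auto simp: carrier_skew_S skew_S_simps(6))
    have "0 \<in> fhomog n i"
      by (simp add: fhomog_def carrier_free_algebra)
    then show "\<zero>\<^bsub>skew_S n \<alpha>\<^esub> \<in> homog (skew_S n \<alpha>) i"
      unfolding skew_S_simps(6) zero[symmetric] by (rule imageI)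
    show "u \<oplus>\<^bsub>skew_S n \<alpha>\<^esub> v \<in> homog (skew_S n \<alpha>) i"
      if uv: "u \<in> homog (skew_S n \<alpha>) i" "v \<in> homog (skew_S n \<alpha>) i"
    proof -
      obtain p p' where p: "p \<in> fhomog n i" "p' \<in> fhomog n i" "u = ?p p" "v = ?p p'"
        using uv by (auto simp: skew_S_simps(6))
      then show ?thesis
        using add[OF p(1,2)[THEN fhomog_closed]] fhomog_add[OF p(1,2)]
        by (auto simp: skew_S_simps(6) intro: image_eqI[rotated])
    qed
    show "u \<otimes>\<^bsub>skew_S n \<alpha>\<^esub> v \<in> homog (skew_S n \<alpha>) (i + j)"
      if uv: "u \<in> homog (skew_S n \<alpha>) i" "v \<in> homog (skew_S n \<alpha>) j"
    proof -
      obtain p p' where p: "p \<in> fhomog n i" "p' \<in> fhomog n j" "u = ?p p" "v = ?p p'"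
        using uv by (auto simp: skew_S_simps(6))
      then show ?thesis
        using mult[OF p(1,2)[THEN fhomog_closed]] fhomog_mult[OF p(1,2)]
        by (auto simp: skew_S_simps(6) intro: image_eqI[rotated])
    qed
  next
    show "homog (skew_S n \<alpha>) 0 = range (\<lambda>a. ?p (fconst a))"
      by (simp add: skew_S_simps(6) fhomog_0 image_image)
    show "x_S n \<alpha> 1 \<in> homog (skew_S n \<alpha>) 1" "x_S n \<alpha> n \<in> homog (skew_S n \<alpha>) 1"
      unfolding skew_S_simps(6) x_S_def using n by (simp_all add: fvar_homog)
    show "\<alpha> 1 n \<noteq> 0"
      by fact
    show "?p (fconst 1) = \<one>\<^bsub>skew_S n \<alpha>\<^esub>"
      using one by (simp add: fconst_def flip: zero_list_def)
  next
    fix a b :: 'k and u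
    show "?p (fconst a) \<in> carrier (skew_S n \<alpha>)"
      by (simp add: carrier_skew_S)
    show "?p (fconst (a + b)) = ?p (fconst a) \<oplus>\<^bsub>skew_S n \<alpha>\<^esub> ?p (fconst b)"
      by (simp add: fconst_def single_add flip: add) (simp add: single_add add flip: fconst_def)
    show "?p (fconst (a * b)) = ?p (fconst a) \<otimes>\<^bsub>skew_S n \<alpha>\<^esub> ?p (fconst b)"
      by (simp flip: mult) (simp add: fconst_def mult_single plus_list_def)
    show "u \<otimes>\<^bsub>skew_S n \<alpha>\<^esub> ?p (fconst a) = ?p (fconst a) \<otimes>\<^bsub>skew_S n \<alpha>\<^esub> u"
      if "u \<in> carrier (skew_S n \<alpha>)"
      using that by (auto simp: carrier_skew_S fconst_central simp flip: mult)
  next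
    have "proj_T n \<alpha> (fvar 1 * fvar 1) \<in> square_ideal n \<alpha>"
      using square_in_ideal[of 1 n \<alpha>] ring_hom_mult[OF proj_T_hom v(1) v(1), of \<alpha>] n
      by (simp add: free_algebra_simps)
    then show "x_S n \<alpha> 1 \<otimes>\<^bsub>skew_S n \<alpha>\<^esub> x_S n \<alpha> 1 = \<zero>\<^bsub>skew_S n \<alpha>\<^esub>"
      unfolding x_S_def mult[OF v(1) v(1), symmetric]
      by (rule proj_S_eq_zero)
  next
    let ?r = "fconst (\<alpha> 1 n) * fvar 1 * fvar n + fvar n * fvar 1"
    have "?r \<in> skew_rels n \<alpha>"
      using n unfolding skew_rels_def by fastforce
    then have "?r \<in> skew_ideal n \<alpha>"
      using skew_rels_in_ideal by blast
    interpret J: ideal "skew_ideal n \<alpha>" "free_algebra n"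
      by (rule ideal_skew_ideal)
    have "proj_T n \<alpha> ?r = \<zero>\<^bsub>skew_T n \<alpha>\<^esub>"
      using J.a_rcos_const[OF \<open>?r \<in> skew_ideal n \<alpha>\<close>] by (simp add: proj_T_def skew_T_def FactRing_def)
    then have "?p ?r = \<zero>\<^bsub>skew_S n \<alpha>\<^esub>"
      using additive_subgroup.zero_closed[OF ideal.axioms(1)[OF ideal_square_ideal]]
      by (intro proj_S_eq_zero) simp
    then show "?p (fconst (\<alpha> 1 n)) \<otimes>\<^bsub>skew_S n \<alpha>\<^esub> x_S n \<alpha> 1 \<otimes>\<^bsub>skew_S n \<alpha>\<^esub> x_S n \<alpha> n
        \<oplus>\<^bsub>skew_S n \<alpha>\<^esub> x_S n \<alpha> n \<otimes>\<^bsub>skew_S n \<alpha>\<^esub> x_S n \<alpha> 1 = \<zero>\<^bsub>skew_S n \<alpha>\<^esub>"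
      by (simp add: x_S_def closed add mult del: One_nat_def)
  next
    fix a b a' b' :: 'k
    let ?lin = "\<lambda>a b :: 'k. fvar n * fconst a + fvar 1 * fconst b"
    have lin: "?lin a b \<in> carrier ?F" for a b
      by (intro closed)
    have eq: "?p (?lin a b) = x_S n \<alpha> n \<otimes>\<^bsub>skew_S n \<alpha>\<^esub> ?p (fconst a)
        \<oplus>\<^bsub>skew_S n \<alpha>\<^esub> x_S n \<alpha> 1 \<otimes>\<^bsub>skew_S n \<alpha>\<^esub> ?p (fconst b)" for a b
      by (simp add: x_S_def closed add mult del: One_nat_def)
    \<comment> \<open>The coefficients are read off at the one-letter words \<open>[n]\<close> and
      \<open>[1]\<close>, which differ because \<open>n \<ge> 2\<close>.\<close>
    have "?lin a b = Poly_Mapping.single [n] a + Poly_Mapping.single [1] b" for a b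
      by (simp add: fvar_def fconst_def mult_single plus_list_def)
    then have look: "Poly_Mapping.lookup (?lin a b) [n] = a" "Poly_Mapping.lookup (?lin a b) [1] = b" for a b
      using n by (simp_all add: lookup_add lookup_single when_def)
    assume "x_S n \<alpha> n \<otimes>\<^bsub>skew_S n \<alpha>\<^esub> ?p (fconst a) \<oplus>\<^bsub>skew_S n \<alpha>\<^esub> x_S n \<alpha> 1 \<otimes>\<^bsub>skew_S n \<alpha>\<^esub> ?p (fconst b) =
      x_S n \<alpha> n \<otimes>\<^bsub>skew_S n \<alpha>\<^esub> ?p (fconst a') \<oplus>\<^bsub>skew_S n \<alpha>\<^esub> x_S n \<alpha> 1 \<otimes>\<^bsub>skew_S n \<alpha>\<^esub> ?p (fconst b')"
    then have "?p (?lin a b) = ?p (?lin a' b')"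
      by (simp only: eq)
    from proj_S_eqD[OF lin lin this, of "[n]"] proj_S_eqD[OF lin lin this, of "[1]"]
    show "a = a' \<and> b = b'"
      unfolding look by simp
  qed
qed

text \<open>An infinite field supplies infinitely many eigenvalues, and \<open>n \<ge> 2\<close>
  supplies a square-zero variable besides the last one.\<close>

theorem theorem7p15:
  fixes \<alpha> :: "nat \<Rightarrow> nat \<Rightarrow> 'k::field" and n r :: nat
  assumes "infinite (UNIV :: 'k set)"
    and "n \<ge> 2"
    and "\<And>i j. i \<in> {1..n} \<Longrightarrow> j \<in> {1..n} \<Longrightarrow> i \<noteq> j \<Longrightarrow> \<alpha> i j * \<alpha> j i = 1"
    and "\<And>i j l. i \<in> {1..n} \<Longrightarrow> j \<in> {1..n} \<Longrightarrow> l \<in> {1..n} \<Longrightarrow>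
           i \<noteq> j \<Longrightarrow> j \<noteq> l \<Longrightarrow> i \<noteq> l \<Longrightarrow> \<alpha> i j * \<alpha> j l * \<alpha> l i = 1"
    and "r \<ge> 1"
  defines "S \<equiv> skew_S n \<alpha>"
  defines "f \<equiv> x_S n \<alpha> n \<otimes>\<^bsub>S\<^esub> x_S n \<alpha> n"
  shows "infinite (iso_classes S {P. indecomposable S (NMF0 S 2 f) P \<and> rk P = r})"
proof -
  \<comment> \<open>A factor of a product equal to 1; this makes the weights of the Jordan
    factorizations invertible.\<close>
  have "\<alpha> 1 n \<noteq> 0"
    using assms(2) assms(3)[of 1 n] by auto
  with assms(2) interpret
    jordan_setup S "\<lambda>a. proj_S n \<alpha> (fconst a)" "x_S n \<alpha> 1" "x_S n \<alpha> n" "\<alpha> 1 n"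
    unfolding S_def by (rule jordan_setup_skew_S)
  show ?thesis
    unfolding f_def by (rule infinite_iso_classes[OF assms(1,5)])
qed

end
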